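(* Let $(X,\mathcal{F})$ be a semi-uniform space, let $B\subset A\subset X$, and let $G$ be an abelian group. Suppose that there exists an element $W\in\mathcal{F}$ such that, for every $U\in\mathcal{F}$ with $U\subset W$, $$U[B]\subset A.$$ Then $$H^*_{VR}(X-B,A-B:\mathcal{F};G)\cong H^*_{VR}(X,A:\mathcal{F};G)\quad\text{and}\quad H_*^{VR}(X-B,A-B:\mathcal{F};G)\cong H_*^{VR}(X,A:\mathcal{F};G).$$
   Context: A semi-uniform structure on a set $X$ is a filter $\mathcal{F}$ on $X\times X$ (a nonempty collection of subsets, not containing $\emptyset$, closed under finite intersections and supersets) such that every member contains the diagonal and, for every $U\in\mathcal{F}$, $U^{-1}=\{(y,x)\mid (x,y)\in U\}$ contains a member of $\mathcal{F}$. The pair $(X,\mathcal{F})$ is a semi-uniform space. For $U\subset X\times X$ and $B\subset X$, $U[B]=\{y\in X\mid (b,y)\in U\text{ for some }b\in B\}$. For $A\subset X$ and $U\in\mathcal{F}$ put $U_A=U\cap(A\times A)$ and $\mathcal{F}_A=\{U_A\mid U\in\mathcal{F},\,U_A\neq\emptyset\}$. For a relation $U\subset X\times X$, the Vietoris-Rips complex $\Sigma^X_U$ is the simplicial complex with vertex set $X$ in which a finite nonempty set is a simplex iff its elements can be ordered as $x_0,\dots,x_q$ (distinct) so that $(x_i,x_j)\in U$ for all $i<j$. (If $U$ is symmetric this is the clique complex of the graph with edge relation $U$.) For $A\subset X$, put $H_*^{VR}(X,A\colon U;G)=H_*(\Sigma^X_U,\Sigma^A_{U_A};G)$ and $H^*_{VR}(X,A\colon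 U;G)=H^*(\Sigma^X_U,\Sigma^A_{U_A};G)$. For $U\subset U'$ in $\mathcal{F}$ the inclusion of simplicial pairs induces maps on homology and cohomology, and one defines $H_*^{VR}(X,A:\mathcal{F};G)=\varprojlim_{U\in\mathcal{F}}H_*^{VR}(X,A\colon U;G)$ and $H^*_{VR}(X,A:\mathcal{F};G)=\varinjlim_{U\in\mathcal{F}}H^*_{VR}(X,A\colon U;G)$. The groups of $(X-B,A-B:\mathcal{F})$ are those of the pair $(X-B,A-B)$ with the semi-uniform structure $\mathcal{F}_{X-B}$ on $X-B$ (and are $0$ if $X-B=\emptyset$). *)

theory Defs
  imports "HOL-Algebra.FiniteProduct" "HOL-Algebra.Product_Groups" "HOL-Combinatorics.Permutations"
begin

section \<open>Semi-uniform spaces\<close>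

definition semi_uniform_space :: "'a set \<Rightarrow> ('a \<times> 'a) set set \<Rightarrow> bool" where
  "semi_uniform_space X F \<longleftrightarrow>
     F \<subseteq> Pow (X \<times> X) \<and> F \<noteq> {} \<and> {} \<notin> F \<and>
     (\<forall>U\<in>F. \<forall>V\<in>F. U \<inter> V \<in> F) \<and>
     (\<forall>U\<in>F. \<forall>V. U \<subseteq> V \<and> V \<subseteq> X \<times> X \<longrightarrow> V \<in> F) \<and>
     (\<forall>U\<in>F. Id_on X \<subseteq> U) \<and>
     (\<forall>U\<in>F. \<exists>V\<in>F. V \<subseteq> U\<inverse>)"

definition restrict_rel :: "'a set \<Rightarrow> ('a \<times> 'a) set \<Rightarrow> ('a \<times> 'a) set" where
  "restrict_rel A U = U \<inter> (A \<times> A)"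

definition trace_structure :: "'a set \<Rightarrow> ('a \<times> 'a) set set \<Rightarrow> ('a \<times> 'a) set set" where
  "trace_structure A F = {restrict_rel A U | U. U \<in> F \<and> restrict_rel A U \<noteq> {}}"


section \<open>Simplicial complexes and their oriented chains\<close>

text \<open>A simplicial complex is represented by its set of (finite, nonempty) simplices.\<close>

definition vr_complex :: "'a set \<Rightarrow> ('a \<times> 'a) set \<Rightarrow> 'a set set" where
  "vr_complex X U =
     {set xs | xs. xs \<noteq> [] \<and> set xs \<subseteq> X \<and> distinct xs \<and>
                   (\<forall>i j. i < j \<and> j < length xs \<longrightarrow> (xs ! i, xs ! j) \<in> U)}"

text \<open>All orderings of all \<open>q\<close>-simplices; an orientation of a simplex is a class of
  orderings modulo even permutations.\<close>

definition ordered_simplices :: "nat \<Rightarrow> 'a set set \<Rightarrow> 'a list set" where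
  "ordered_simplices q K = {s. distinct s \<and> length s = Suc q \<and> set s \<in> K}"

text \<open>\<open>q\<close>-cochains with coefficients in \<open>G\<close>, i.e. homomorphisms from the oriented simplicial
  chain group \<open>C\<^sub>q(K)\<close> to \<open>G\<close>: functions on oriented simplices that change sign when the
  orientation is reversed. The coefficient group is written multiplicatively. Functions are
  extended by the neutral element to lists that are not ordered \<open>q\<close>-simplices of \<open>K\<close>.\<close>

definition cochains ::
  "nat \<Rightarrow> 'a set set \<Rightarrow> ('g, 'm) monoid_scheme \<Rightarrow> ('a list \<Rightarrow> 'g) set" where
  "cochains q K G =
     {f. (\<forall>s\<in>ordered_simplices q K. f s \<in> carrier G) \<and>
         (\<forall>s\<in>ordered_simplices q K. \<forall>p. p permutes {..<Suc q} \<longrightarrow>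
              f (permute_list p s) = f s [^]\<^bsub>G\<^esub> sign p) \<and>
         (\<forall>s. s \<notin> ordered_simplices q K \<longrightarrow> f s = \<one>\<^bsub>G\<^esub>)}"

text \<open>\<open>q\<close>-chains: the finitely supported functions of this kind; \<open>c s\<close> is the coefficient of
  the oriented simplex \<open>[s]\<close> in the chain \<open>c\<close>.\<close>

definition chains ::
  "nat \<Rightarrow> 'a set set \<Rightarrow> ('g, 'm) monoid_scheme \<Rightarrow> ('a list \<Rightarrow> 'g) set" where
  "chains q K G = {c \<in> cochains q K G. finite {s. c s \<noteq> \<one>\<^bsub>G\<^esub>}}"

text \<open>A set \<open>C\<close> of chains or cochains as a group under pointwise multiplication.\<close>

definition fun_group :: "('a list \<Rightarrow> 'g) set \<Rightarrow> ('g, 'm) monoid_scheme \<Rightarrow> ('a list \<Rightarrow> 'g) monoid"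
  where "fun_group C G =
     \<lparr>carrier = C, monoid.mult = (\<lambda>c d s. c s \<otimes>\<^bsub>G\<^esub> d s), one = (\<lambda>s. \<one>\<^bsub>G\<^esub>)\<rparr>"

definition face :: "nat \<Rightarrow> 'a list \<Rightarrow> 'a list" where
  "face i s = take i s @ drop (Suc i) s"

text \<open>The boundary \<open>\<partial>[x\<^sub>0,\<dots>,x\<^sub>q] = \<Sum>\<^sub>i (-1)\<^sup>i [x\<^sub>0,\<dots>,x\<^sub>q without x\<^sub>i]\<close> in terms of coefficients:
  since \<open>[x\<^sub>i, x\<^sub>0,\<dots>,x\<^sub>q without x\<^sub>i] = (-1)\<^sup>i [x\<^sub>0,\<dots>,x\<^sub>q]\<close>, the coefficient of \<open>[s]\<close> in \<open>\<partial>c\<close> is the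
  sum over \<open>x\<close> of the coefficient of \<open>[x,s]\<close> in \<open>c\<close>. The usual formula is recovered in
  \<open>boundary_elementary_chain\<close> below. The empty list is excluded since the chain complex is not
  augmented (the boundary of a \<open>0\<close>-chain is trivial).\<close>

definition boundary :: "('g, 'm) monoid_scheme \<Rightarrow> ('a list \<Rightarrow> 'g) \<Rightarrow> 'a list \<Rightarrow> 'g" where
  "boundary G c s =
     (if s = [] then \<one>\<^bsub>G\<^esub> else finprod G (\<lambda>x. c (x # s)) {x. c (x # s) \<noteq> \<one>\<^bsub>G\<^esub>})"

definition coboundary ::
  "nat \<Rightarrow> 'a set set \<Rightarrow> ('g, 'm) monoid_scheme \<Rightarrow> ('a list \<Rightarrow> 'g) \<Rightarrow> 'a list \<Rightarrow> 'g" where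
  "coboundary q K G f s =
     (if s \<in> ordered_simplices (Suc q) K
      then finprod G (\<lambda>i. f (face i s) [^]\<^bsub>G\<^esub> ((-1) ^ i :: int)) {..Suc q}
      else \<one>\<^bsub>G\<^esub>)"

subsection \<open>The boundary of an elementary chain\<close>

text \<open>The chain \<open>g[xs]\<close>.\<close>

definition elementary_chain :: "('g, 'm) monoid_scheme \<Rightarrow> 'g \<Rightarrow> 'a list \<Rightarrow> 'a list \<Rightarrow> 'g" where
  "elementary_chain G g xs s =
     (if mset s = mset xs
      then g [^]\<^bsub>G\<^esub> sign (THE p. p permutes {..<length xs} \<and> permute_list p xs = s)
      else \<one>\<^bsub>G\<^esub>)"

lemma elementary_chain_permute_list:
  assumes "distinct xs" "p permutes {..<length xs}"
  shows "elementary_chain G g xs (permute_list p xs) = g [^]\<^bsub>G\<^esub> sign p"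
proof -
  have "r = p" if r: "r permutes {..<length xs}" "permute_list r xs = permute_list p xs" for r
  proof
    fix i show "r i = p i"
    proof (cases "i < length xs")
      case True
      then have "xs ! r i = xs ! p i"
        using r assms by (metis permute_list_nth)
      with True r assms show ?thesis
        by (metis lessThan_iff nth_eq_iff_index_eq permutes_in_image)
    next
      case False
      then show ?thesis using r assms by (simp add: permutes_not_in)
    qed
  qed
  then have "(THE r. r permutes {..<length xs} \<and> permute_list r xs = permute_list p xs) = p"
    using assms by (intro the_equality) auto
  with assms show ?thesis by (simp add: elementary_chain_def)
qed

fun front_cycle :: "nat \<Rightarrow> nat \<Rightarrow> nat" where
  "front_cycle i 0 = i"
| "front_cycle i (Suc k) = (if k < i then k else Suc k)"

lemma front_cycle_permutes_sign:
  "i < n \<Longrightarrow> front_cycle i permutes {..<n} \<and> sign (front_cycle i) = (-1) ^ i"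
proof (induction i)
  case 0
  have "front_cycle 0 = id"
  proof
    fix k show "front_cycle 0 k = id k" by (cases k) auto
  qed
  then show ?case by (metis permutes_id power_0 sign_id)
next
  case (Suc i)
  have eq: "front_cycle (Suc i) = Transposition.transpose i (Suc i) \<circ> front_cycle i"
  proof
    fix k show "front_cycle (Suc i) k = (Transposition.transpose i (Suc i) \<circ> front_cycle i) k"
      by (cases k) (auto simp: Transposition.transpose_def)
  qed
  have t: "Transposition.transpose i (Suc i) permutes {..<n}"
    using Suc by (intro permutes_swap_id) auto
  have p: "front_cycle i permutes {..<n}" "sign (front_cycle i) = (-1) ^ i"
    using Suc by auto
  have "sign (front_cycle (Suc i)) = sign (Transposition.transpose i (Suc i)) * sign (front_cycle i)"
    unfolding eq using t p by (intro sign_compose permutes_imp_permutation[of "{..<n}"]) auto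
  with p(2) have "sign (front_cycle (Suc i)) = (-1) ^ Suc i"
    by (simp add: sign_swap_id)
  moreover have "front_cycle (Suc i) permutes {..<n}"
    unfolding eq by (rule permutes_compose[OF p(1) t])
  ultimately show ?case by blast
qed

lemma (in comm_group) elementary_chain_face:
  assumes "distinct xs" "i < length xs" "g \<in> carrier G"
  shows "elementary_chain G g xs (xs ! i # ys) =
         elementary_chain G (g [^] ((-1) ^ i :: int)) (face i xs) ys"
proof (cases "mset ys = mset (face i xs)")
  case False
  have "mset xs = add_mset (xs ! i) (mset (face i xs))"
    unfolding face_def
    by (subst id_take_nth_drop[OF assms(2)]) simp
  with False show ?thesis by (simp add: elementary_chain_def)
next
  case True
  define m where "m = length (face i xs)"
  have len: "length xs = Suc m" using assms by (simp add: m_def face_def)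
  obtain r where r: "r permutes {..<m}" "permute_list r (face i xs) = ys"
    using mset_eq_permutation[OF True] m_def by metis
  define l where "l = map_permutation {..<m} Suc r"
  have l_perm: "l permutes Suc ` {..<m}"
    unfolding l_def by (intro map_permutation_permutes) (auto simp: bij_betw_def r)
  have l: "l permutes {..<Suc m}"
    by (rule permutes_subset[OF l_perm]) auto
  have l0: "l 0 = 0" using l_perm by (auto simp: permutes_def)
  have lS: "l (Suc j) = Suc (r j)" if "j < m" for j
    unfolding l_def using that by (subst map_permutation_apply) auto
  have sl: "sign l = sign r"
    unfolding l_def by (rule sign_map_permutation) (use r in auto)
  have fc: "front_cycle i permutes {..<Suc m}" "sign (front_cycle i) = (-1) ^ i"
    using front_cycle_permutes_sign[of i "Suc m"] assms len by auto
  define p where "p = front_cycle i \<circ> l"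
  have p: "p permutes {..<length xs}"
    unfolding p_def len by (rule permutes_compose[OF l fc(1)])
  have sp: "sign p = (-1) ^ i * sign r"
    unfolding p_def using l fc sl
    by (subst sign_compose) (auto intro: permutes_imp_permutation[of "{..<Suc m}"])
  have nth_face: "face i xs ! j = xs ! (if j < i then j else Suc j)" if "j < m" for j
    using that assms len by (auto simp: face_def nth_append min_def)
  have "permute_list p xs = xs ! i # ys"
  proof (rule nth_equalityI)
    have lys: "length ys = m" using r m_def by auto
    then show "length (permute_list p xs) = length (xs ! i # ys)" by (simp add: len)
    fix k assume k: "k < length (permute_list p xs)"
    then have "permute_list p xs ! k = xs ! p k" using p by (simp add: permute_list_nth)
    also have "\<dots> = (xs ! i # ys) ! k"
    proof (cases k)
      case 0 then show ?thesis by (simp add: p_def l0)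
    next
      case (Suc j)
      then have j: "j < m" using k len by simp
      then have rj: "r j < m" using r permutes_in_image by fastforce
      have "ys ! j = face i xs ! r j"
        using r j m_def permute_list_nth by metis
      then show ?thesis using Suc j rj by (simp add: p_def lS nth_face)
    qed
    finally show "permute_list p xs ! k = (xs ! i # ys) ! k" .
  qed
  then have "elementary_chain G g xs (xs ! i # ys) = g [^] sign p"
    using elementary_chain_permute_list[OF assms(1) p] by metis
  also have "\<dots> = (g [^] ((-1) ^ i :: int)) [^] sign r"
    using assms by (simp add: sp int_pow_pow)
  also have "\<dots> = elementary_chain G (g [^] ((-1) ^ i :: int)) (face i xs) ys"
  proof -
    have "distinct (face i xs)"
      using assms(1) by (simp add: face_def set_take_disj_set_drop_if_distinct)
    then show ?thesis
      using elementary_chain_permute_list[of "face i xs" r] r m_def by metis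
  qed
  finally show ?thesis .
qed

lemma (in comm_group) boundary_elementary_chain:
  assumes "distinct xs" "length xs = Suc (Suc q)" "g \<in> carrier G"
  shows "boundary G (elementary_chain G g xs) ys =
         (\<Otimes>i\<in>{..Suc q}. elementary_chain G (g [^] ((-1) ^ i :: int)) (face i xs) ys)"
proof (cases "ys = []")
  case True
  have "face i xs \<noteq> []" for i using assms(2) by (cases i) (auto simp: face_def)
  then show ?thesis using True by (simp add: boundary_def elementary_chain_def)
next
  case False
  have cl: "elementary_chain G h zs s \<in> carrier G" if "h \<in> carrier G" for h zs s
    using that by (simp add: elementary_chain_def)
  have "boundary G (elementary_chain G g xs) ys =
        (\<Otimes>x\<in>{x. elementary_chain G g xs (x # ys) \<noteq> \<one>}. elementary_chain G g xs (x # ys))"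
    using False by (simp add: boundary_def)
  also have "\<dots> = (\<Otimes>x\<in>set xs. elementary_chain G g xs (x # ys))"
  proof (rule finprod_mono_neutral_cong_left)
    show "{x. elementary_chain G g xs (x # ys) \<noteq> \<one>} \<subseteq> set xs"
      by (auto simp: elementary_chain_def split: if_splits dest!: arg_cong[where f = set_mset])
  qed (use assms cl in auto)
  also have "set xs = (!) xs ` {..Suc q}"
    using assms(2) by (auto simp: set_conv_nth image_iff less_Suc_eq_le)
  also have "(\<Otimes>x\<in>(!) xs ` {..Suc q}. elementary_chain G g xs (x # ys)) =
             (\<Otimes>i\<in>{..Suc q}. elementary_chain G g xs (xs ! i # ys))"
    using assms cl by (intro finprod_reindex) (auto intro!: inj_on_nth)
  also have "\<dots> = (\<Otimes>i\<in>{..Suc q}. elementary_chain G (g [^] ((-1) ^ i :: int)) (face i xs) ys)"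
    using assms
    by (intro finprod_cong' refl Pi_I elementary_chain_face cl int_pow_closed) auto
  finally show ?thesis .
qed


section \<open>Simplicial homology and cohomology of a pair\<close>

text \<open>For a subcomplex \<open>L\<close> of \<open>K\<close>. As for singular homology in the library, \<open>H\<^sub>q(K,L;G)\<close> is
  presented as chains with boundary in \<open>L\<close> modulo chains homologous in \<open>K\<close> to chains in \<open>L\<close>.
  For \<open>q = 0\<close> the boundary condition holds automatically.\<close>

definition relcycles ::
  "nat \<Rightarrow> 'a set set \<Rightarrow> 'a set set \<Rightarrow> ('g, 'm) monoid_scheme \<Rightarrow> ('a list \<Rightarrow> 'g) set" where
  "relcycles q K L G = {c \<in> chains q K G. boundary G c \<in> chains (q - 1) L G}"

definition relboundaries ::
  "nat \<Rightarrow> 'a set set \<Rightarrow> 'a set set \<Rightarrow> ('g, 'm) monoid_scheme \<Rightarrow> ('a list \<Rightarrow> 'g) set" where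
  "relboundaries q K L G =
     {(\<lambda>s. boundary G d s \<otimes>\<^bsub>G\<^esub> e s) | d e. d \<in> chains (Suc q) K G \<and> e \<in> chains q L G}"

definition simplicial_homology ::
  "nat \<Rightarrow> 'a set set \<Rightarrow> 'a set set \<Rightarrow> ('g, 'm) monoid_scheme \<Rightarrow> ('a list \<Rightarrow> 'g) set monoid" where
  "simplicial_homology q K L G =
     fun_group (relcycles q K L G) G Mod relboundaries q K L G"

text \<open>\<open>Hom(C\<^sub>q(K)/C\<^sub>q(L), G)\<close>\<close>

definition relcochains ::
  "nat \<Rightarrow> 'a set set \<Rightarrow> 'a set set \<Rightarrow> ('g, 'm) monoid_scheme \<Rightarrow> ('a list \<Rightarrow> 'g) set" where
  "relcochains q K L G =
     {f \<in> cochains q K G. \<forall>s\<in>ordered_simplices q L. f s = \<one>\<^bsub>G\<^esub>}"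

definition relcocycles ::
  "nat \<Rightarrow> 'a set set \<Rightarrow> 'a set set \<Rightarrow> ('g, 'm) monoid_scheme \<Rightarrow> ('a list \<Rightarrow> 'g) set" where
  "relcocycles q K L G = {f \<in> relcochains q K L G. coboundary q K G f = (\<lambda>s. \<one>\<^bsub>G\<^esub>)}"

definition relcoboundaries ::
  "nat \<Rightarrow> 'a set set \<Rightarrow> 'a set set \<Rightarrow> ('g, 'm) monoid_scheme \<Rightarrow> ('a list \<Rightarrow> 'g) set" where
  "relcoboundaries q K L G =
     (case q of 0 \<Rightarrow> {\<lambda>s. \<one>\<^bsub>G\<^esub>} | Suc r \<Rightarrow> coboundary r K G ` relcochains r K L G)"

definition simplicial_cohomology ::
  "nat \<Rightarrow> 'a set set \<Rightarrow> 'a set set \<Rightarrow> ('g, 'm) monoid_scheme \<Rightarrow> ('a list \<Rightarrow> 'g) set monoid" where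
  "simplicial_cohomology q K L G =
     fun_group (relcocycles q K L G) G Mod relcoboundaries q K L G"

text \<open>The homomorphisms induced by an inclusion \<open>(K,L) \<subseteq> (K',L')\<close>. A homology class is a coset \<open>\<xi>\<close>;
  its image is the coset containing \<open>\<xi>\<close>, as chains are extended by the neutral element. In
  cohomology, the image of the coset \<open>\<xi>\<close> is the coset containing all restrictions of elements
  of \<open>\<xi>\<close>.\<close>

definition homology_inclusion ::
  "nat \<Rightarrow> 'a set set \<Rightarrow> 'a set set \<Rightarrow> ('g, 'm) monoid_scheme \<Rightarrow>
   ('a list \<Rightarrow> 'g) set \<Rightarrow> ('a list \<Rightarrow> 'g) set" where
  "homology_inclusion q K' L' G \<xi> =
     relboundaries q K' L' G <#>\<^bsub>fun_group (relcycles q K' L' G) G\<^esub> \<xi>"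

definition restrict_cochain ::
  "nat \<Rightarrow> 'a set set \<Rightarrow> ('g, 'm) monoid_scheme \<Rightarrow> ('a list \<Rightarrow> 'g) \<Rightarrow> 'a list \<Rightarrow> 'g" where
  "restrict_cochain q K G f s = (if s \<in> ordered_simplices q K then f s else \<one>\<^bsub>G\<^esub>)"

definition cohomology_restriction ::
  "nat \<Rightarrow> 'a set set \<Rightarrow> 'a set set \<Rightarrow> ('g, 'm) monoid_scheme \<Rightarrow>
   ('a list \<Rightarrow> 'g) set \<Rightarrow> ('a list \<Rightarrow> 'g) set" where
  "cohomology_restriction q K L G \<xi> =
     relcoboundaries q K L G <#>\<^bsub>fun_group (relcocycles q K L G) G\<^esub> (restrict_cochain q K G ` \<xi>)"


section \<open>Limits of systems of abelian groups\<close>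

text \<open>A system over the index set \<open>I\<close> has transition maps \<open>f i j\<close> from \<open>H i\<close> to \<open>H j\<close> whenever
  \<open>R i j\<close>. The direct limit is the direct sum modulo the identifications of \<open>a \<in> H i\<close> with
  \<open>f i j a \<in> H j\<close>. Both limits are trivial groups if \<open>I = {}\<close>.\<close>

definition inverse_limit ::
  "'i set \<Rightarrow> ('i \<Rightarrow> 'i \<Rightarrow> bool) \<Rightarrow> ('i \<Rightarrow> 'h monoid) \<Rightarrow> ('i \<Rightarrow> 'i \<Rightarrow> 'h \<Rightarrow> 'h) \<Rightarrow> ('i \<Rightarrow> 'h) monoid"
  where "inverse_limit I R H f =
     (product_group I H)
       \<lparr>carrier := {x \<in> carrier (product_group I H).
                     \<forall>i\<in>I. \<forall>j\<in>I. R i j \<longrightarrow> f i j (x i) = x j}\<rparr>"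

definition sum_inclusion :: "'i set \<Rightarrow> ('i \<Rightarrow> 'h monoid) \<Rightarrow> 'i \<Rightarrow> 'h \<Rightarrow> 'i \<Rightarrow> 'h" where
  "sum_inclusion I H i a = (\<lambda>k\<in>I. if k = i then a else \<one>\<^bsub>H k\<^esub>)"

definition direct_limit ::
  "'i set \<Rightarrow> ('i \<Rightarrow> 'i \<Rightarrow> bool) \<Rightarrow> ('i \<Rightarrow> 'h monoid) \<Rightarrow> ('i \<Rightarrow> 'i \<Rightarrow> 'h \<Rightarrow> 'h) \<Rightarrow>
   ('i \<Rightarrow> 'h) set monoid"
  where "direct_limit I R H f =
     sum_group I H Mod
       generate (sum_group I H)
         {sum_inclusion I H i a \<otimes>\<^bsub>sum_group I H\<^esub>
            inv\<^bsub>sum_group I H\<^esub> (sum_inclusion I H j (f i j a)) | i j a.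
          i \<in> I \<and> j \<in> I \<and> R i j \<and> a \<in> carrier (H i)}"


section \<open>Vietoris-Rips homology and cohomology\<close>

definition vr_homology_at ::
  "nat \<Rightarrow> 'a set \<Rightarrow> 'a set \<Rightarrow> ('a \<times> 'a) set \<Rightarrow> ('g, 'm) monoid_scheme \<Rightarrow> ('a list \<Rightarrow> 'g) set monoid"
  where "vr_homology_at q X A U G =
     simplicial_homology q (vr_complex X U) (vr_complex A (restrict_rel A U)) G"

definition vr_cohomology_at ::
  "nat \<Rightarrow> 'a set \<Rightarrow> 'a set \<Rightarrow> ('a \<times> 'a) set \<Rightarrow> ('g, 'm) monoid_scheme \<Rightarrow> ('a list \<Rightarrow> 'g) set monoid"
  where "vr_cohomology_at q X A U G =
     simplicial_cohomology q (vr_complex X U) (vr_complex A (restrict_rel A U)) G"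

text \<open>\<open>(X, F)\<close> is the semi-uniform space and \<open>A\<close> the subset. In the case \<open>X = {}\<close>, arising
  with \<open>F = trace_structure {} F' = {}\<close>, the index set is empty and the groups are trivial.\<close>

definition vr_homology ::
  "nat \<Rightarrow> 'a set \<Rightarrow> 'a set \<Rightarrow> ('a \<times> 'a) set set \<Rightarrow> ('g, 'm) monoid_scheme \<Rightarrow>
   (('a \<times> 'a) set \<Rightarrow> ('a list \<Rightarrow> 'g) set) monoid"
  where "vr_homology q X A F G =
     inverse_limit F (\<lambda>U U'. U \<subseteq> U') (\<lambda>U. vr_homology_at q X A U G)
       (\<lambda>U U'. homology_inclusion q (vr_complex X U') (vr_complex A (restrict_rel A U')) G)"

definition vr_cohomology ::
  "nat \<Rightarrow> 'a set \<Rightarrow> 'a set \<Rightarrow> ('a \<times> 'a) set set \<Rightarrow> ('g, 'm) monoid_scheme \<Rightarrow>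
   (('a \<times> 'a) set \<Rightarrow> ('a list \<Rightarrow> 'g) set) set monoid"
  where "vr_cohomology q X A F G =
     direct_limit F (\<lambda>U' U. U \<subseteq> U') (\<lambda>U. vr_cohomology_at q X A U G)
       (\<lambda>U' U. cohomology_restriction q (vr_complex X U) (vr_complex A (restrict_rel A U)) G)"

end

theory Submission
  imports Defs
begin

text \<open>Since \<open>F\<close> is closed under intersection and contains \<open>W\<inverse>\<close>, the relations \<open>U \<subseteq> W \<inter> W\<inverse>\<close> are
  cofinal in \<open>F\<close>, and their traces are cofinal in the trace structure on \<open>X - B\<close>. For such \<open>U\<close>
  every simplex with a vertex in \<open>B\<close> lies in \<open>A\<close>: a vertex adjacent to \<open>b \<in> B\<close>, on either side of
  the ordering, belongs to \<open>A\<close>. Hence the complex of \<open>X\<close> is the union of those of \<open>X - B\<close> and \<open>A\<close>,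
  whose intersection is the complex of \<open>A - B\<close>, and excision already holds on the chain level. Both
  limits may be computed over the cofinal index set.\<close>

section \<open>Limits of systems of abelian groups\<close>

text \<open>The limits are concrete constructions, a quotient of a direct sum and a subgroup of a
  product, so isomorphisms between them have to be produced by hand. For direct limits both
  directions come from a universal property and are compared on the classes of single group
  elements; for inverse limits one map restricts families and is shown to be bijective. Passing from
  \<open>F\<close> to relations on \<open>X - B\<close> is not a bijection of index sets: different
  relations may have the same trace. Cofinality is therefore stated for a monotone map \<phi> of
  index sets instead of a subset inclusion. Homology and cohomology are not treated alike. A
  relative cochain of the pair on \<open>X\<close> is neutral on \<open>A\<close>, so as a function
  it already is a relative cochain of the pair on \<open>X - B\<close>, and the two cohomology
  systems coincide over the cofinal indices. The relative cycles of the two pairs are different sets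
  of functions, so homology needs isomorphisms that are natural in the relation; these are built
  into the comparison of inverse limits.\<close>

lemma comm_group_sum_group:
  assumes "\<And>i. i \<in> I \<Longrightarrow> comm_group (H i)"
  shows "comm_group (sum_group I H)"
proof (rule group.group_comm_groupI)
  have H: "group (H i)" if "i \<in> I" for i
    using assms[OF that] by (rule comm_group.axioms)
  show "group (sum_group I H)"
    using H by simp
  show "x \<otimes>\<^bsub>sum_group I H\<^esub> y = y \<otimes>\<^bsub>sum_group I H\<^esub> x"
    if "x \<in> carrier (sum_group I H)" "y \<in> carrier (sum_group I H)" for x y
    using that assms
    by (auto simp: carrier_sum_group H PiE_iff comm_group_def comm_monoid.m_comm intro!: restrict_ext)
qed

lemma sum_inclusion_hom:
  assumes H: "\<And>k. k \<in> I \<Longrightarrow> group (H k)" and i: "i \<in> I"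
  shows "sum_inclusion I H i \<in> hom (H i) (sum_group I H)"
proof (rule homI)
  have one: "\<one>\<^bsub>H k\<^esub> \<in> carrier (H k)" if "k \<in> I" for k
    using H[OF that] by (simp add: group.is_monoid)
  fix a assume a: "a \<in> carrier (H i)"
  have "finite {k \<in> I. sum_inclusion I H i a k \<noteq> \<one>\<^bsub>H k\<^esub>}"
    by (rule finite_subset[of _ "{i}"]) (auto simp: sum_inclusion_def)
  then show "sum_inclusion I H i a \<in> carrier (sum_group I H)"
    using a one by (auto simp: carrier_sum_group H sum_inclusion_def)
next
  fix a b assume "a \<in> carrier (H i)" "b \<in> carrier (H i)"
  show "sum_inclusion I H i (a \<otimes>\<^bsub>H i\<^esub> b) = sum_inclusion I H i a \<otimes>\<^bsub>sum_group I H\<^esub> sum_inclusion I H i b"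
    by (auto simp: sum_inclusion_def fun_eq_iff H group.is_monoid)
qed

text \<open>The support is finite, so coordinates can be split off one at a time; the induction is
  on the support.\<close>

lemma sum_group_induct [consumes 1, case_names group one step]:
  assumes x: "x \<in> carrier (sum_group I H)"
    and H: "\<And>k. k \<in> I \<Longrightarrow> group (H k)"
    and one: "P \<one>\<^bsub>sum_group I H\<^esub>"
    and step: "\<And>i a y. \<lbrakk>i \<in> I; a \<in> carrier (H i); y \<in> carrier (sum_group I H); P y\<rbrakk>
                 \<Longrightarrow> P (sum_inclusion I H i a \<otimes>\<^bsub>sum_group I H\<^esub> y)"
  shows "P x"
proof -
  have fin: "finite {i \<in> I. x i \<noteq> \<one>\<^bsub>H i\<^esub>}"
    using x by (simp add: carrier_sum_group H)
  have "P x" if "finite T" "x \<in> carrier (sum_group I H)" "{i \<in> I. x i \<noteq> \<one>\<^bsub>H i\<^esub>} = T" for x T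
    using that
  proof (induction T arbitrary: x)
    case empty
    then have "x = \<one>\<^bsub>sum_group I H\<^esub>"
      by (auto simp: carrier_sum_group H PiE_iff extensional_def)
    then show ?case using one by (simp only:)
  next
    case (insert i T)
    \<comment> \<open>Resetting coordinate \<open>i\<close> to the identity removes exactly
      \<open>i\<close> from the support.\<close>
    define y where "y = (\<lambda>k\<in>I. if k = i then \<one>\<^bsub>H k\<^esub> else x k)"
    have i: "i \<in> I" using insert by auto
    have xi: "x i \<in> carrier (H i)"
      using insert i by (auto simp: carrier_sum_group H PiE_iff)
    have supp: "{k \<in> I. y k \<noteq> \<one>\<^bsub>H k\<^esub>} = T"
      using insert by (auto simp: y_def)
    have y: "y \<in> carrier (sum_group I H)"
    proof -
      have "y k \<in> carrier (H k)" if "k \<in> I" for k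
        using insert.prems(1) that by (auto simp: y_def carrier_sum_group H PiE_iff group.is_monoid)
      then show ?thesis
        using insert.hyps(1) supp by (auto simp: carrier_sum_group H y_def)
    qed
    have "x = sum_inclusion I H i (x i) \<otimes>\<^bsub>sum_group I H\<^esub> y"
      using insert(4) by (auto simp: sum_inclusion_def y_def fun_eq_iff carrier_sum_group H PiE_iff
          extensional_def group.is_monoid)
    then show ?case
      using step[OF i xi y insert.IH[OF y supp]] by simp
  qed
  from this[OF fin x refl] show ?thesis .
qed

text \<open>The homomorphism multiplies the values of \<open>h i\<close> over the support, a finite
  product that does not depend on an order because \<open>T\<close> is abelian.\<close>

lemma sum_group_universal:
  assumes H: "\<And>i. i \<in> I \<Longrightarrow> group (H i)" and T: "comm_group T"
    and h: "\<And>i. i \<in> I \<Longrightarrow> h i \<in> hom (H i) T"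
  obtains g where "g \<in> hom (sum_group I H) T"
    "\<And>i a. \<lbrakk>i \<in> I; a \<in> carrier (H i)\<rbrakk> \<Longrightarrow> g (sum_inclusion I H i a) = h i a"
proof
  interpret T: comm_group T by (rule T)
  define supp where "supp x = {i \<in> I. x i \<noteq> \<one>\<^bsub>H i\<^esub>}" for x
  define g where "g x = finprod T (\<lambda>i. h i (x i)) (supp x)" for x
  have h1: "h i \<one>\<^bsub>H i\<^esub> = \<one>\<^bsub>T\<^esub>" if "i \<in> I" for i
    using hom_one[OF h H] that by simp
  have hc: "h i a \<in> carrier T" if "i \<in> I" "a \<in> carrier (H i)" for i a
    using h[OF that(1)] that(2) by (auto simp: hom_def)
  \<comment> \<open>The support of a product can be smaller than the union of the supports of its
    factors. Enlarging the index set by factors equal to one lets all three products run over the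
    same \<open>S\<close>.\<close>
  have g_eq: "g x = finprod T (\<lambda>i. h i (x i)) S"
    if "finite S" "supp x \<subseteq> S" "S \<subseteq> I" "\<And>i. i \<in> I \<Longrightarrow> x i \<in> carrier (H i)" for x S
    unfolding g_def using that h1
    by (intro T.finprod_mono_neutral_cong_left) (auto simp: supp_def hc)
  show "g \<in> hom (sum_group I H) T"
  proof (rule homI)
    fix x assume "x \<in> carrier (sum_group I H)"
    then show "g x \<in> carrier T"
      unfolding g_def by (intro T.finprod_closed) (auto simp: supp_def carrier_sum_group H hc PiE_iff)
  next
    fix x y assume xy: "x \<in> carrier (sum_group I H)" "y \<in> carrier (sum_group I H)"
    define S where "S = supp x \<union> supp y"
    have S: "finite S" "S \<subseteq> I"
      using xy by (auto simp: S_def supp_def carrier_sum_group H)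
    have c: "x i \<in> carrier (H i)" "y i \<in> carrier (H i)" if "i \<in> I" for i
      using xy that by (auto simp: carrier_sum_group H PiE_iff)
    let ?xy = "x \<otimes>\<^bsub>sum_group I H\<^esub> y"
    have m: "?xy i = x i \<otimes>\<^bsub>H i\<^esub> y i" if "i \<in> I" for i
      using that by simp
    have "g ?xy = finprod T (\<lambda>i. h i (?xy i)) S"
    proof (rule g_eq)
      show "supp ?xy \<subseteq> S"
        using H by (auto simp: supp_def S_def group.is_monoid)
      show "?xy i \<in> carrier (H i)" if "i \<in> I" for i
        using that c H by (auto simp: group.is_monoid monoid.m_closed)
    qed (use S in auto)
    also have "\<dots> = finprod T (\<lambda>i. h i (x i) \<otimes>\<^bsub>T\<^esub> h i (y i)) S"
      using S c h m by (intro T.finprod_cong') (auto simp: hom_mult hc subset_iff)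
    also have "\<dots> = finprod T (\<lambda>i. h i (x i)) S \<otimes>\<^bsub>T\<^esub> finprod T (\<lambda>i. h i (y i)) S"
      using S c by (intro T.finprod_multf) (auto simp: hc)
    also have "\<dots> = g x \<otimes>\<^bsub>T\<^esub> g y"
      using S c by (subst (1 2) g_eq[of S]) (auto simp: S_def)
    finally show "g ?xy = g x \<otimes>\<^bsub>T\<^esub> g y" .
  qed
  show "g (sum_inclusion I H i a) = h i a" if i: "i \<in> I" and a: "a \<in> carrier (H i)" for i a
  proof -
    have "g (sum_inclusion I H i a) = finprod T (\<lambda>k. h k (sum_inclusion I H i a k)) {i}"
      using i a H by (intro g_eq) (auto simp: supp_def sum_inclusion_def group.is_monoid)
    then show ?thesis
      using i a by (simp add: sum_inclusion_def hc)
  qed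
qed

section \<open>Direct limits and their universal property\<close>

locale directed_system =
  fixes I :: "'i set" and R :: "'i \<Rightarrow> 'i \<Rightarrow> bool" and H :: "'i \<Rightarrow> 'h monoid"
    and f :: "'i \<Rightarrow> 'i \<Rightarrow> 'h \<Rightarrow> 'h"
  assumes comm: "i \<in> I \<Longrightarrow> comm_group (H i)"
    and trans_hom: "\<lbrakk>i \<in> I; j \<in> I; R i j\<rbrakk> \<Longrightarrow> f i j \<in> hom (H i) (H j)"
begin

lemma grp: "i \<in> I \<Longrightarrow> group (H i)"
  using comm by (rule comm_group.axioms)

abbreviation "S \<equiv> sum_group I H"
abbreviation "D \<equiv> direct_limit I R H f"

text \<open>A copy of the generating set inside \<open>direct_limit\<close>, so that
  \<open>D_eq\<close> holds by unfolding.\<close>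

definition relators :: "('i \<Rightarrow> 'h) set" where
  "relators = {sum_inclusion I H i a \<otimes>\<^bsub>S\<^esub> inv\<^bsub>S\<^esub> (sum_inclusion I H j (f i j a)) | i j a.
     i \<in> I \<and> j \<in> I \<and> R i j \<and> a \<in> carrier (H i)}"

definition limit_inclusion :: "'i \<Rightarrow> 'h \<Rightarrow> ('i \<Rightarrow> 'h) set" where
  "limit_inclusion i a = generate S relators #>\<^bsub>S\<^esub> sum_inclusion I H i a"

sublocale S: comm_group S
  by (rule comm_group_sum_group) (rule comm)

lemma incl_hom: "i \<in> I \<Longrightarrow> sum_inclusion I H i \<in> hom (H i) S"
  by (rule sum_inclusion_hom) (auto intro: grp)

lemma incl_closed: "\<lbrakk>i \<in> I; a \<in> carrier (H i)\<rbrakk> \<Longrightarrow> sum_inclusion I H i a \<in> carrier S"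
  using incl_hom by (rule hom_in_carrier)

lemma trans_closed: "\<lbrakk>i \<in> I; j \<in> I; R i j; a \<in> carrier (H i)\<rbrakk> \<Longrightarrow> f i j a \<in> carrier (H j)"
  using trans_hom by (rule hom_in_carrier)

lemma relators_subset: "relators \<subseteq> carrier S"
  unfolding relators_def
  by (auto simp del: mult_sum_group inv_sum_group intro!: S.m_closed S.inv_closed incl_closed trans_closed)

sublocale N: normal "generate S relators" S
  by (intro S.subgroup_imp_normal S.generate_is_subgroup relators_subset)

lemma D_eq: "D = S Mod generate S relators"
  by (simp only: direct_limit_def relators_def)

sublocale D: comm_group D
  unfolding D_eq by (rule S.abelian_FactGroup) (rule N.subgroup_axioms)

lemma limit_inclusion_hom: "i \<in> I \<Longrightarrow> limit_inclusion i \<in> hom (H i) D"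
  unfolding D_eq limit_inclusion_def
  using hom_compose[OF incl_hom N.r_coset_hom_Mod] by (simp add: comp_def)

lemma limit_inclusion_closed: "\<lbrakk>i \<in> I; a \<in> carrier (H i)\<rbrakk> \<Longrightarrow> limit_inclusion i a \<in> carrier D"
  using limit_inclusion_hom by (rule hom_in_carrier)

lemma limit_inclusion_trans:
  assumes "i \<in> I" "j \<in> I" "R i j" "a \<in> carrier (H i)"
  shows "limit_inclusion j (f i j a) = limit_inclusion i a"
proof -
  have "sum_inclusion I H i a \<otimes>\<^bsub>S\<^esub> inv\<^bsub>S\<^esub> (sum_inclusion I H j (f i j a)) \<in> generate S relators"
    using assms unfolding relators_def by (blast intro: generate.incl)
  then have "sum_inclusion I H i a \<in> generate S relators #>\<^bsub>S\<^esub> sum_inclusion I H j (f i j a)"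
    using assms by (intro N.rcos_module_rev) (auto intro!: incl_closed trans_closed S.is_group)
  then show ?thesis
    unfolding limit_inclusion_def
    by (rule S.repr_independence) (use assms in \<open>auto intro!: incl_closed trans_closed N.subgroup_axioms\<close>)
qed

text \<open>Every class has a representative in the direct sum, so induction on finite supports
  descends to the quotient. Directedness is not among the assumptions of this locale, so an element
  is a product of classes of single group elements, not always one such class.\<close>

lemma direct_limit_induct [consumes 1, case_names one step]:
  assumes x: "x \<in> carrier D" and one: "P \<one>\<^bsub>D\<^esub>"
    and step: "\<And>i a y. \<lbrakk>i \<in> I; a \<in> carrier (H i); y \<in> carrier D; P y\<rbrakk>
                 \<Longrightarrow> P (limit_inclusion i a \<otimes>\<^bsub>D\<^esub> y)"
  shows "P x"
proof -
  obtain z where z: "z \<in> carrier S" "x = generate S relators #>\<^bsub>S\<^esub> z"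
    using x by (auto simp: D_eq carrier_FactGroup)
  have "P (generate S relators #>\<^bsub>S\<^esub> z)"
    using z(1)
  proof (induction rule: sum_group_induct)
    case (group k)
    then show ?case by (rule grp)
  next
    case one
    have "generate S relators #>\<^bsub>S\<^esub> \<one>\<^bsub>S\<^esub> = \<one>\<^bsub>D\<^esub>"
      using S.coset_mult_one[OF N.subset] by (simp add: D_eq)
    then show ?case using assms(2) by metis
  next
    case (step i a y)
    have "generate S relators #>\<^bsub>S\<^esub> (sum_inclusion I H i a \<otimes>\<^bsub>S\<^esub> y)
        = limit_inclusion i a \<otimes>\<^bsub>D\<^esub> (generate S relators #>\<^bsub>S\<^esub> y)"
      unfolding D_eq limit_inclusion_def mult_FactGroup using step
      by (intro N.rcos_sum[symmetric] incl_closed)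
    moreover have "generate S relators #>\<^bsub>S\<^esub> y \<in> carrier D"
      using step by (auto simp: D_eq carrier_FactGroup)
    ultimately show ?case
      using assms(3)[OF step(1,2) _ step(4)] by metis
  qed
  with z show ?thesis by simp
qed

lemma direct_limit_hom_eqI:
  assumes T: "group T" and g: "g \<in> hom D T" and g': "g' \<in> hom D T"
    and eq: "\<And>i a. \<lbrakk>i \<in> I; a \<in> carrier (H i)\<rbrakk> \<Longrightarrow> g (limit_inclusion i a) = g' (limit_inclusion i a)"
    and x: "x \<in> carrier D"
  shows "g x = g' x"
  using x
proof (induction rule: direct_limit_induct)
  case one
  show ?case using hom_one[OF g _ T] hom_one[OF g' _ T] D.is_group by simp
next
  case (step i a y)
  then show ?case
    using hom_mult[OF g limit_inclusion_closed step(3)] hom_mult[OF g' limit_inclusion_closed step(3)] eq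
    by simp
qed

text \<open>Compatibility of the maps \<open>h i\<close> says that the induced map on the direct sum
  sends every relator to the identity, so it is constant on cosets.\<close>

lemma direct_limit_universal:
  assumes T: "comm_group T"
    and h: "\<And>i. i \<in> I \<Longrightarrow> h i \<in> hom (H i) T"
    and compat: "\<And>i j a. \<lbrakk>i \<in> I; j \<in> I; R i j; a \<in> carrier (H i)\<rbrakk> \<Longrightarrow> h j (f i j a) = h i a"
  obtains g where "g \<in> hom D T"
    "\<And>i a. \<lbrakk>i \<in> I; a \<in> carrier (H i)\<rbrakk> \<Longrightarrow> g (limit_inclusion i a) = h i a"
proof -
  interpret T: comm_group T by (rule T)
  obtain k where k: "k \<in> hom S T"
    and ki: "\<And>i a. \<lbrakk>i \<in> I; a \<in> carrier (H i)\<rbrakk> \<Longrightarrow> k (sum_inclusion I H i a) = h i a"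
    using sum_group_universal[of I H T h] grp T h by metis
  interpret k: group_hom S T k
    by unfold_locales (rule k)
  have "relators \<subseteq> kernel S T k"
  proof
    fix x assume "x \<in> relators"
    then obtain i j a where ij: "i \<in> I" "j \<in> I" "R i j" "a \<in> carrier (H i)"
      and x: "x = sum_inclusion I H i a \<otimes>\<^bsub>S\<^esub> inv\<^bsub>S\<^esub> (sum_inclusion I H j (f i j a))"
      unfolding relators_def by blast
    have c: "sum_inclusion I H i a \<in> carrier S" "sum_inclusion I H j (f i j a) \<in> carrier S"
      using ij by (auto intro!: incl_closed trans_closed)
    have "k x = h i a \<otimes>\<^bsub>T\<^esub> inv\<^bsub>T\<^esub> h j (f i j a)"
      unfolding x using c ij k.hom_mult[OF c(1) S.inv_closed[OF c(2)]] k.hom_inv[OF c(2)] 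
      by (simp add: ki trans_closed del: mult_sum_group inv_sum_group)
    also have "\<dots> = \<one>\<^bsub>T\<^esub>"
      using compat[OF ij] h[OF ij(1)] ij by (simp add: hom_in_carrier)
    finally show "x \<in> kernel S T k"
      using c by (simp add: kernel_def x del: mult_sum_group inv_sum_group)
  qed
  then have ker: "generate S relators \<subseteq> kernel S T k"
    by (rule S.generate_subgroup_incl) (rule k.subgroup_kernel)
  have "k x = k y" if xy: "x \<in> carrier S" "y \<in> carrier S"
    and eq: "generate S relators #>\<^bsub>S\<^esub> x = generate S relators #>\<^bsub>S\<^esub> y" for x y
  proof -
    have "x \<in> generate S relators #>\<^bsub>S\<^esub> y"
      using S.rcos_self[OF xy(1) N.subgroup_axioms] eq by simp
    then obtain n where "n \<in> generate S relators" "x = n \<otimes>\<^bsub>S\<^esub> y"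
      by (auto simp: r_coset_def)
    then show ?thesis
      using ker xy k.hom_mult[of n y] by (auto simp: kernel_def simp del: mult_sum_group)
  qed
  then obtain g where g: "g \<in> hom (S Mod generate S relators) T"
    and gk: "\<And>x. x \<in> carrier S \<Longrightarrow> g (generate S relators #>\<^bsub>S\<^esub> x) = k x"
    using FactGroup_universal[OF k N.normal_axioms] by metis
  show thesis
  proof
    show "g \<in> hom D T" using g by (simp add: D_eq)
    show "g (limit_inclusion i a) = h i a" if "i \<in> I" "a \<in> carrier (H i)" for i a
      using that by (simp add: limit_inclusion_def gk incl_closed ki)
  qed
qed

text \<open>Together with \<open>trivial_inverse_limit\<close>, this serves the case
  \<open>X - B = {}\<close>.\<close>

lemma trivial_direct_limit:
  assumes "\<And>i. i \<in> I \<Longrightarrow> trivial_group (H i)"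
  shows "trivial_group D"
proof -
  have "x = \<one>\<^bsub>D\<^esub>" if "x \<in> carrier D" for x
    using that
  proof (induction rule: direct_limit_induct)
    case (step i a y)
    then have "a = \<one>\<^bsub>H i\<^esub>" using assms by (auto simp: trivial_group_def)
    then have "limit_inclusion i a = \<one>\<^bsub>D\<^esub>"
      using hom_one[OF limit_inclusion_hom] step grp D.is_group by simp
    with step show ?case by simp
  qed simp
  then show ?thesis
    using D.trivial_group_subset by blast
qed

end

text \<open>The transition maps are compared on carriers only, which is enough because the relators
  involve no other arguments. On arbitrary sets of functions the restriction maps of the application
  need not agree.\<close>

lemma direct_limit_cong:
  assumes H: "\<And>i. i \<in> I \<Longrightarrow> H i = H' i"
    and f: "\<And>i j a. \<lbrakk>i \<in> I; j \<in> I; R i j; a \<in> carrier (H i)\<rbrakk> \<Longrightarrow> f i j a = f' i j a"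
  shows "direct_limit I R H f = direct_limit I R H' f'"
proof -
  have prod: "product_group I H = product_group I H'"
    using H by (auto simp: product_group_def fun_eq_iff cong: PiE_cong)
  have "{x \<in> \<Pi>\<^sub>E i\<in>I. carrier (H i). finite {i \<in> I. x i \<noteq> \<one>\<^bsub>H i\<^esub>}} =
        {x \<in> \<Pi>\<^sub>E i\<in>I. carrier (H' i). finite {i \<in> I. x i \<noteq> \<one>\<^bsub>H' i\<^esub>}}"
    using H by (simp cong: PiE_cong conj_cong)
  then have sum: "sum_group I H = sum_group I H'"
    by (simp add: sum_group_def prod)
  have incl: "sum_inclusion I H = sum_inclusion I H'"
    using H by (auto simp: sum_inclusion_def fun_eq_iff)
  have "{sum_inclusion I H' i a \<otimes>\<^bsub>sum_group I H'\<^esub>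
            inv\<^bsub>sum_group I H'\<^esub> (sum_inclusion I H' j (f i j a)) | i j a.
          i \<in> I \<and> j \<in> I \<and> R i j \<and> a \<in> carrier (H i)} =
        {sum_inclusion I H' i a \<otimes>\<^bsub>sum_group I H'\<^esub>
            inv\<^bsub>sum_group I H'\<^esub> (sum_inclusion I H' j (f' i j a)) | i j a.
          i \<in> I \<and> j \<in> I \<and> R i j \<and> a \<in> carrier (H' i)}"
    (is "{?A i j a | i j a. ?P i j a} = {?B i j a | i j a. ?Q i j a}")
  proof -
    have "?P i j a \<longleftrightarrow> ?Q i j a" for i j a
      using H by auto
    moreover have "?A i j a = ?B i j a" if "?P i j a" for i j a
      using f that by simp
    ultimately have "(x = ?A i j a \<and> ?P i j a) \<longleftrightarrow> (x = ?B i j a \<and> ?Q i j a)" for x i j a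
      by (metis (lifting))
    then show ?thesis
      by (simp only:)
  qed
  then show ?thesis
    by (simp only: direct_limit_def sum incl)
qed

section \<open>Cofinal change of the index set\<close>

locale functorial_system = directed_system J Q K g
  for J :: "'j set" and Q :: "'j \<Rightarrow> 'j \<Rightarrow> bool" and K :: "'j \<Rightarrow> 'h monoid"
    and g :: "'j \<Rightarrow> 'j \<Rightarrow> 'h \<Rightarrow> 'h" +
  assumes order_trans: "\<lbrakk>i \<in> J; j \<in> J; k \<in> J; Q i j; Q j k\<rbrakk> \<Longrightarrow> Q i k"
    and functorial: "\<lbrakk>i \<in> J; j \<in> J; k \<in> J; Q i j; Q j k; a \<in> carrier (K i)\<rbrakk>
                     \<Longrightarrow> g j k (g i j a) = g i k a"
begin

text \<open>Two mutually inverse maps come from the universal property: one sends the class at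
  \<open>i\<close> to the class at \<open>\<phi> i\<close>, the other pushes an element at
  \<open>j\<close> forward to some \<open>\<phi> i\<close> above \<open>j\<close>. Directedness of
  \<open>I\<close> makes the second independent of the choice of \<open>i\<close>.\<close>

lemma direct_limit_cofinal:
  assumes dir: "\<And>i j. \<lbrakk>i \<in> I; j \<in> I\<rbrakk> \<Longrightarrow> \<exists>k\<in>I. R i k \<and> R j k"
    and \<phi>: "\<And>i. i \<in> I \<Longrightarrow> \<phi> i \<in> J"
    and mono: "\<And>i j. \<lbrakk>i \<in> I; j \<in> I; R i j\<rbrakk> \<Longrightarrow> Q (\<phi> i) (\<phi> j)"
    and cofinal: "\<And>j. j \<in> J \<Longrightarrow> \<exists>i\<in>I. Q j (\<phi> i)"
  shows "direct_limit I R (\<lambda>i. K (\<phi> i)) (\<lambda>i j. g (\<phi> i) (\<phi> j)) \<cong> D"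
proof -
  interpret I: directed_system I R "\<lambda>i. K (\<phi> i)" "\<lambda>i j. g (\<phi> i) (\<phi> j)"
    by (rule directed_system.intro) (auto intro: \<phi> mono comm trans_hom)
  obtain u where u: "u \<in> hom I.D D"
    and u_incl: "\<And>i a. \<lbrakk>i \<in> I; a \<in> carrier (K (\<phi> i))\<rbrakk> \<Longrightarrow>
                   u (I.limit_inclusion i a) = limit_inclusion (\<phi> i) a"
  proof (rule I.direct_limit_universal[of D "\<lambda>i. limit_inclusion (\<phi> i)"])
    show "comm_group D" by (rule D.comm_group_axioms)
    show "limit_inclusion (\<phi> i) \<in> hom (K (\<phi> i)) D" if "i \<in> I" for i
      using that by (intro limit_inclusion_hom \<phi>)
    show "limit_inclusion (\<phi> j) (g (\<phi> i) (\<phi> j) a) = limit_inclusion (\<phi> i) a"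
      if "i \<in> I" "j \<in> I" "R i j" "a \<in> carrier (K (\<phi> i))" for i j a
      using that by (intro limit_inclusion_trans \<phi> mono)
  qed (rule that, assumption+)
  obtain c where c: "\<And>j. j \<in> J \<Longrightarrow> c j \<in> I" "\<And>j. j \<in> J \<Longrightarrow> Q j (\<phi> (c j))"
    using cofinal by metis
  \<comment> \<open>Two admissible indices are compared at a common successor \<open>k\<close>;
    functoriality turns both routes into \<open>g j (\<phi> k)\<close>.\<close>
  have indep: "I.limit_inclusion i (g j (\<phi> i) a) = I.limit_inclusion i' (g j (\<phi> i') a)"
    if j: "j \<in> J" "a \<in> carrier (K j)" and i: "i \<in> I" "Q j (\<phi> i)" and i': "i' \<in> I" "Q j (\<phi> i')" for i i' j a
  proof -
    obtain k where k: "k \<in> I" "R i k" "R i' k"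
      using dir i(1) i'(1) by blast
    have "I.limit_inclusion l (g j (\<phi> l) a) = I.limit_inclusion k (g j (\<phi> k) a)"
      if l: "l \<in> I" "Q j (\<phi> l)" "R l k" for l
    proof -
      have "I.limit_inclusion l (g j (\<phi> l) a) = I.limit_inclusion k (g (\<phi> l) (\<phi> k) (g j (\<phi> l) a))"
        using l k j \<phi> by (intro I.limit_inclusion_trans[symmetric]) (auto intro!: trans_closed)
      then show ?thesis
        using l k j \<phi> mono by (simp add: functorial)
    qed
    with k i i' show ?thesis by metis
  qed
  obtain v where v: "v \<in> hom D I.D"
    and v_incl: "\<And>j a. \<lbrakk>j \<in> J; a \<in> carrier (K j)\<rbrakk> \<Longrightarrow>
                   v (limit_inclusion j a) = I.limit_inclusion (c j) (g j (\<phi> (c j)) a)"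
  proof (rule direct_limit_universal[of I.D "\<lambda>j a. I.limit_inclusion (c j) (g j (\<phi> (c j)) a)"])
    show "comm_group I.D" by (rule I.D.comm_group_axioms)
    show "(\<lambda>a. I.limit_inclusion (c j) (g j (\<phi> (c j)) a)) \<in> hom (K j) I.D" if "j \<in> J" for j
      using hom_compose[OF trans_hom I.limit_inclusion_hom, of j "c j"] that c \<phi> by (simp add: comp_def)
    show "I.limit_inclusion (c j) (g j (\<phi> (c j)) (g i j a)) = I.limit_inclusion (c i) (g i (\<phi> (c i)) a)"
      if "i \<in> J" "j \<in> J" "Q i j" "a \<in> carrier (K i)" for i j a
    proof -
      \<comment> \<open>The index chosen for \<open>j\<close> is also admissible for
        \<open>i\<close>.\<close>
      have "Q i (\<phi> (c j))" using that c \<phi> order_trans by metis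
      then have "I.limit_inclusion (c j) (g i (\<phi> (c j)) a) = I.limit_inclusion (c i) (g i (\<phi> (c i)) a)"
        using that c by (intro indep) auto
      then show ?thesis using that c \<phi> by (simp add: functorial)
    qed
  qed (rule that, assumption+)
  have vu: "v (u x) = x" if "x \<in> carrier I.D" for x
  proof -
    have "(v \<circ> u) x = id x"
    proof (rule I.direct_limit_hom_eqI[where g = "v \<circ> u" and g' = id, OF I.D.is_group])
      show "v \<circ> u \<in> hom I.D I.D" using hom_compose[OF u v] .
      show "(v \<circ> u) (I.limit_inclusion i a) = id (I.limit_inclusion i a)"
        if i: "i \<in> I" "a \<in> carrier (K (\<phi> i))" for i a
      proof -
        let ?i' = "c (\<phi> i)"
        have i': "\<phi> i \<in> J" "?i' \<in> I" "\<phi> ?i' \<in> J" "Q (\<phi> i) (\<phi> ?i')"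
          using i(1) by (simp_all add: c \<phi>)
        \<comment> \<open>\<open>Q (\<phi> i) (\<phi> ?i')\<close> does not yield
          \<open>R i ?i'\<close>, so the two indices of \<open>I\<close> are compared through a
          common successor.\<close>
        obtain k where k: "k \<in> I" "R i k" "R ?i' k"
          using dir[OF i(1) i'(2)] by blast
        have k': "\<phi> k \<in> J" "Q (\<phi> ?i') (\<phi> k)"
          using k i' by (simp_all add: \<phi> mono)
        have "(v \<circ> u) (I.limit_inclusion i a) = I.limit_inclusion ?i' (g (\<phi> i) (\<phi> ?i') a)"
          using i i' by (simp add: u_incl v_incl)
        also have "\<dots> = I.limit_inclusion k (g (\<phi> ?i') (\<phi> k) (g (\<phi> i) (\<phi> ?i') a))"
          by (intro I.limit_inclusion_trans[symmetric] trans_closed i i' k)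
        also have "\<dots> = I.limit_inclusion k (g (\<phi> i) (\<phi> k) a)"
          using i i' k' by (simp add: functorial)
        also have "\<dots> = I.limit_inclusion i a"
          by (intro I.limit_inclusion_trans i k)
        finally show ?thesis by simp
      qed
    qed (use that in \<open>auto simp: hom_def\<close>)
    then show ?thesis by simp
  qed
  have uv: "u (v x) = x" if "x \<in> carrier D" for x
  proof -
    have "(u \<circ> v) x = id x"
    proof (rule direct_limit_hom_eqI[where g = "u \<circ> v" and g' = id, OF D.is_group])
      show "u \<circ> v \<in> hom D D" using hom_compose[OF v u] .
      show "(u \<circ> v) (limit_inclusion j a) = id (limit_inclusion j a)"
        if "j \<in> J" "a \<in> carrier (K j)" for j a
      proof -
        have j: "c j \<in> I" "\<phi> (c j) \<in> J" "Q j (\<phi> (c j))"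
          using that by (simp_all add: c \<phi>)
        then show ?thesis
          using that by (simp add: v_incl u_incl trans_closed limit_inclusion_trans)
      qed
    qed (use that in \<open>auto simp: hom_def\<close>)
    then show ?thesis by simp
  qed
  have "bij_betw u (carrier I.D) (carrier D)"
    by (rule bij_betw_byWitness[of _ v]) (use u v vu uv in \<open>auto simp: hom_def\<close>)
  with u show ?thesis
    unfolding is_iso_def iso_def by blast
qed

section \<open>Inverse limits\<close>

lemma inverse_limit_group: "group (inverse_limit J Q K g)"
proof -
  have "subgroup {x \<in> carrier (product_group J K). \<forall>i\<in>J. \<forall>j\<in>J. Q i j \<longrightarrow> g i j (x i) = x j} (product_group J K)"
  proof (rule group.subgroupI)
    show "group (product_group J K)" using grp by simp
    have "g i j \<one>\<^bsub>K i\<^esub> = \<one>\<^bsub>K j\<^esub>" if "i \<in> J" "j \<in> J" "Q i j" for i j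
      using hom_one[OF trans_hom grp grp] that by simp
    then have "\<one>\<^bsub>product_group J K\<^esub> \<in> {x \<in> carrier (product_group J K).
        \<forall>i\<in>J. \<forall>j\<in>J. Q i j \<longrightarrow> g i j (x i) = x j}"
      using grp by (simp add: group.is_monoid)
    then show "{x \<in> carrier (product_group J K). \<forall>i\<in>J. \<forall>j\<in>J. Q i j \<longrightarrow> g i j (x i) = x j} \<noteq> {}"
      by blast
    fix x assume x: "x \<in> {x \<in> carrier (product_group J K). \<forall>i\<in>J. \<forall>j\<in>J. Q i j \<longrightarrow> g i j (x i) = x j}"
    have "g i j (inv\<^bsub>K i\<^esub> x i) = inv\<^bsub>K j\<^esub> x j" if "i \<in> J" "j \<in> J" "Q i j" for i j
    proof -
      interpret group_hom "K i" "K j" "g i j"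
        using that by (simp add: group_hom_def group_hom_axioms_def grp trans_hom)
      show ?thesis using x that hom_inv[of "x i"] by (auto simp: PiE_iff)
    qed
    moreover have "x i \<in> carrier (K i)" if "i \<in> J" for i
      using x that by (simp add: PiE_iff)
    ultimately show "inv\<^bsub>product_group J K\<^esub> x \<in> {x \<in> carrier (product_group J K). \<forall>i\<in>J. \<forall>j\<in>J. Q i j \<longrightarrow> g i j (x i) = x j}"
      using x grp by simp
    fix y assume y: "y \<in> {x \<in> carrier (product_group J K). \<forall>i\<in>J. \<forall>j\<in>J. Q i j \<longrightarrow> g i j (x i) = x j}"
    have "g i j (x i \<otimes>\<^bsub>K i\<^esub> y i) = x j \<otimes>\<^bsub>K j\<^esub> y j" if "i \<in> J" "j \<in> J" "Q i j" for i j
      using x y that hom_mult[OF trans_hom, of i j "x i" "y i"] by auto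
    then show "x \<otimes>\<^bsub>product_group J K\<^esub> y \<in> {x \<in> carrier (product_group J K). \<forall>i\<in>J. \<forall>j\<in>J. Q i j \<longrightarrow> g i j (x i) = x j}"
      using x y grp by (auto simp: group.is_monoid monoid.m_closed PiE_iff)
  qed auto
  then show ?thesis
    unfolding inverse_limit_def by (intro group.subgroup_imp_group product_group grp)
qed

text \<open>Reindexing along \<phi> and replacing groups by isomorphic ones happen together, since
  the homology groups of the two pairs are isomorphic but not equal. A coordinate at
  \<open>j\<close> is determined by the coordinate at any \<open>\<phi> i\<close> below it, which
  gives injectivity; for surjectivity the missing coordinates are defined by pushing such values
  forward.\<close>

lemma inverse_limit_cofinal:
  assumes H: "\<And>i. i \<in> I \<Longrightarrow> group (H i)"
    and dir: "\<And>i j. \<lbrakk>i \<in> I; j \<in> I\<rbrakk> \<Longrightarrow> \<exists>k\<in>I. R k i \<and> R k j"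
    and \<phi>: "\<And>i. i \<in> I \<Longrightarrow> \<phi> i \<in> J"
    and mono: "\<And>i j. \<lbrakk>i \<in> I; j \<in> I; R i j\<rbrakk> \<Longrightarrow> Q (\<phi> i) (\<phi> j)"
    and cofinal: "\<And>j. j \<in> J \<Longrightarrow> \<exists>i\<in>I. Q (\<phi> i) j"
    and h: "\<And>i. i \<in> I \<Longrightarrow> h i \<in> iso (K (\<phi> i)) (H i)"
    and natural: "\<And>i j a. \<lbrakk>i \<in> I; j \<in> I; R i j; a \<in> carrier (K (\<phi> i))\<rbrakk> \<Longrightarrow>
                    f i j (h i a) = h j (g (\<phi> i) (\<phi> j) a)"
  shows "inverse_limit J Q K g \<cong> inverse_limit I R H f"
proof -
  let ?J = "inverse_limit J Q K g" and ?I = "inverse_limit I R H f"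
  define u where "u y = (\<lambda>i\<in>I. h i (y (\<phi> i)))" for y
  have hh: "h i \<in> hom (K (\<phi> i)) (H i)" if "i \<in> I" for i
    using h[OF that] by (simp add: iso_def)
  have hinj: "inj_on (h i) (carrier (K (\<phi> i)))" if "i \<in> I" for i
    using h[OF that] by (simp add: iso_def bij_betw_def)
  have J: "y \<in> carrier ?J \<longleftrightarrow> y \<in> (\<Pi>\<^sub>E j\<in>J. carrier (K j)) \<and>
      (\<forall>i\<in>J. \<forall>j\<in>J. Q i j \<longrightarrow> g i j (y i) = y j)" for y
    by (simp add: inverse_limit_def)
  have I: "x \<in> carrier ?I \<longleftrightarrow> x \<in> (\<Pi>\<^sub>E i\<in>I. carrier (H i)) \<and>
      (\<forall>i\<in>I. \<forall>j\<in>I. R i j \<longrightarrow> f i j (x i) = x j)" for x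
    by (simp add: inverse_limit_def)
  have "u \<in> hom ?J ?I"
  proof (rule homI)
    show "u y \<in> carrier ?I" if "y \<in> carrier ?J" for y
      using that hh \<phi> mono unfolding I J
      by (auto simp: u_def PiE_iff natural intro!: hom_in_carrier[OF hh])
    show "u (y \<otimes>\<^bsub>?J\<^esub> z) = u y \<otimes>\<^bsub>?I\<^esub> u z" if "y \<in> carrier ?J" "z \<in> carrier ?J" for y z
      using that hh \<phi> unfolding J by (auto simp: inverse_limit_def u_def fun_eq_iff PiE_iff hom_mult)
  qed
  moreover have "inj_on u (carrier ?J)"
  proof (rule inj_onI)
    fix y z assume yz: "y \<in> carrier ?J" "z \<in> carrier ?J" "u y = u z"
    have "y (\<phi> i) = z (\<phi> i)" if "i \<in> I" for i
    proof (rule inj_onD[OF hinj[OF that]])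
      show "h i (y (\<phi> i)) = h i (z (\<phi> i))"
        using fun_cong[OF yz(3), of i] that by (simp add: u_def)
    qed (use yz that \<phi> in \<open>auto simp: J\<close>)
    note eq\<phi> = this
    have eq: "y j = z j" if j: "j \<in> J" for j
    proof -
      obtain i where i: "i \<in> I" "Q (\<phi> i) j"
        using cofinal[OF j] by blast
      have "g (\<phi> i) j (y (\<phi> i)) = y j" "g (\<phi> i) j (z (\<phi> i)) = z j"
        using yz(1,2) \<phi>[OF i(1)] i(2) j unfolding J by blast+
      then show ?thesis using eq\<phi>[OF i(1)] by simp
    qed
    have "y \<in> (\<Pi>\<^sub>E j\<in>J. carrier (K j))" "z \<in> (\<Pi>\<^sub>E j\<in>J. carrier (K j))"
      using yz(1,2) unfolding J by blast+
    then show "y = z"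
      by (rule PiE_ext) (rule eq)
  qed
  moreover have "x \<in> u ` carrier ?J" if x: "x \<in> carrier ?I" for x
  proof -
    obtain c where c: "\<And>j. j \<in> J \<Longrightarrow> c j \<in> I" "\<And>j. j \<in> J \<Longrightarrow> Q (\<phi> (c j)) j"
      using cofinal by metis
    \<comment> \<open>The family \<open>x\<close> is transported back through the isomorphisms;
      naturality and injectivity of \<open>h j\<close> make \<open>w\<close> compatible.\<close>
    define w where "w i = inv_into (carrier (K (\<phi> i))) (h i) (x i)" for i
    have w: "w i \<in> carrier (K (\<phi> i))" "h i (w i) = x i" if "i \<in> I" for i
    proof -
      have "x i \<in> h i ` carrier (K (\<phi> i))"
        using x h[OF that] that by (auto simp: I iso_def bij_betw_def)
      then show "w i \<in> carrier (K (\<phi> i))" "h i (w i) = x i"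
        by (auto simp: w_def inv_into_into f_inv_into_f)
    qed
    have w_trans: "g (\<phi> i) (\<phi> j) (w i) = w j" if "i \<in> I" "j \<in> I" "R i j" for i j
    proof (rule inj_onD[OF hinj[OF that(2)]])
      show "h j (g (\<phi> i) (\<phi> j) (w i)) = h j (w j)"
        using that w x natural[of i j "w i"] by (simp add: I)
    qed (use that w \<phi> mono in \<open>auto intro: trans_closed\<close>)
    \<comment> \<open>Both values come from \<open>w k\<close> at a common predecessor
      \<open>k\<close> of the two indices.\<close>
    have indep: "g (\<phi> i) j (w i) = g (\<phi> i') j (w i')"
      if "j \<in> J" "i \<in> I" "i' \<in> I" "Q (\<phi> i) j" "Q (\<phi> i') j" for i i' j
    proof -
      obtain k where k: "k \<in> I" "R k i" "R k i'"
        using dir \<open>i \<in> I\<close> \<open>i' \<in> I\<close> by blast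
      have "g (\<phi> l) j (w l) = g (\<phi> k) j (w k)" if "l \<in> I" "R k l" "Q (\<phi> l) j" for l
        using functorial[of "\<phi> k" "\<phi> l" j "w k"] w_trans[of k l] that k \<open>j \<in> J\<close> \<phi> mono w by simp
      then show ?thesis using k that by metis
    qed
    define y where "y = (\<lambda>j\<in>J. g (\<phi> (c j)) j (w (c j)))"
    have "y \<in> carrier ?J"
      unfolding J
    proof (intro conjI ballI impI)
      show "y \<in> (\<Pi>\<^sub>E j\<in>J. carrier (K j))"
        using c w \<phi> by (auto simp: y_def intro!: trans_closed)
      show "g i j (y i) = y j" if "i \<in> J" "j \<in> J" "Q i j" for i j
      proof -
        have "Q (\<phi> (c i)) j" using that c \<phi> order_trans by metis
        then have "g (\<phi> (c i)) j (w (c i)) = g (\<phi> (c j)) j (w (c j))"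
          using that c by (intro indep) auto
        then show ?thesis using that c \<phi> w by (simp add: y_def functorial)
      qed
    qed
    moreover have "u y = x"
    proof
      fix i show "u y i = x i"
      proof (cases "i \<in> I")
        case True
        let ?i' = "c (\<phi> i)"
        have i': "?i' \<in> I" "Q (\<phi> ?i') (\<phi> i)" using True c \<phi> by auto
        \<comment> \<open>Again \<open>i\<close> and \<open>?i'\<close> need not be related in
          \<open>I\<close>, so both are reached from below.\<close>
        obtain k where k: "k \<in> I" "R k i" "R k ?i'"
          using dir True i' by blast
        have "y (\<phi> i) = g (\<phi> ?i') (\<phi> i) (w ?i')"
          using True \<phi> by (simp add: y_def)
        also have "\<dots> = g (\<phi> k) (\<phi> i) (w k)"
          by (intro indep i' k \<phi> mono True)
        also have "\<dots> = w i" using w_trans k True by simp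
        finally show ?thesis using w True by (simp add: u_def)
      next
        case False
        then show ?thesis using x by (auto simp: u_def I PiE_iff extensional_def)
      qed
    qed
    ultimately show ?thesis by blast
  qed
  ultimately have "u \<in> iso ?J ?I"
    unfolding iso_iff by (auto simp: hom_def)
  then show ?thesis
    unfolding is_iso_def by blast
qed

lemma trivial_inverse_limit:
  assumes "\<And>i. i \<in> J \<Longrightarrow> trivial_group (K i)"
  shows "trivial_group (inverse_limit J Q K g)"
proof -
  have "carrier (inverse_limit J Q K g) \<subseteq> carrier (product_group J K)"
    by (auto simp: inverse_limit_def)
  also have "\<dots> = {\<one>\<^bsub>product_group J K\<^esub>}"
    using assms trivial_product_group[of J K] unfolding trivial_group_def by blast
  finally show ?thesis
    using group.trivial_group_alt[OF inverse_limit_group] by blast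
qed

end

lemma trivial_groups_isomorphic:
  assumes "trivial_group G" "trivial_group H"
  shows "G \<cong> H"
proof -
  have "(\<lambda>_. \<one>\<^bsub>H\<^esub>) \<in> iso G H"
    using assms by (auto simp: trivial_group_def iso_iff hom_def group.is_monoid)
  then show ?thesis
    unfolding is_iso_def by blast
qed

section \<open>Maps induced on quotient groups\<close>

text \<open>The induced maps are defined on cosets as sets, by multiplying the image with
  \<open>B'\<close>. Since \<open>h\<close> maps \<open>B\<close> into \<open>B'\<close>, the image
  of a coset of \<open>B\<close> lies in one coset of \<open>B'\<close>, and multiplication by
  \<open>B'\<close> fills it up.\<close>

lemma set_mult_image_coset:
  assumes "group Z" "group Z'" "subgroup B Z" "subgroup B' Z'"
    and h: "h \<in> hom Z Z'" and hB: "h ` B \<subseteq> B'" and c: "c \<in> carrier Z"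
  shows "B' <#>\<^bsub>Z'\<^esub> (h ` (B #>\<^bsub>Z\<^esub> c)) = B' #>\<^bsub>Z'\<^esub> h c"
proof -
  interpret Z: group Z by fact
  interpret Z': group Z' by fact
  interpret B: subgroup B Z by fact
  interpret B': subgroup B' Z' by fact
  have hc: "h c \<in> carrier Z'" using h c by (rule hom_in_carrier)
  have hB': "h b \<in> B'" if "b \<in> B" for b using that hB by blast
  show ?thesis
  proof
    show "B' <#>\<^bsub>Z'\<^esub> (h ` (B #>\<^bsub>Z\<^esub> c)) \<subseteq> B' #>\<^bsub>Z'\<^esub> h c"
    proof
      fix x assume "x \<in> B' <#>\<^bsub>Z'\<^esub> (h ` (B #>\<^bsub>Z\<^esub> c))"
      then obtain b b' where b: "b \<in> B" "b' \<in> B'" "x = b' \<otimes>\<^bsub>Z'\<^esub> h (b \<otimes>\<^bsub>Z\<^esub> c)"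
        by (auto simp: set_mult_def r_coset_def)
      then have "x = (b' \<otimes>\<^bsub>Z'\<^esub> h b) \<otimes>\<^bsub>Z'\<^esub> h c"
        using c hc hB' hom_mult[OF h] by (simp add: Z'.m_assoc)
      moreover have "b' \<otimes>\<^bsub>Z'\<^esub> h b \<in> B'"
        using b hB' by simp
      ultimately show "x \<in> B' #>\<^bsub>Z'\<^esub> h c"
        by (auto simp: r_coset_def)
    qed
    have "c \<in> B #>\<^bsub>Z\<^esub> c"
      by (rule Z.rcos_self[OF c B.subgroup_axioms])
    then show "B' #>\<^bsub>Z'\<^esub> h c \<subseteq> B' <#>\<^bsub>Z'\<^esub> (h ` (B #>\<^bsub>Z\<^esub> c))"
      by (auto simp: set_mult_def r_coset_def[of Z'])
  qed
qed

text \<open>A common setting for both theories: \<open>h\<close> is the identity for inclusions in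
  homology and the restriction of cochains in cohomology.\<close>

locale quotient_map = Z: comm_group Z + Z': comm_group Z' + B: subgroup B Z + B': subgroup B' Z'
  for Z :: "('c, 'm) monoid_scheme" and B and Z' :: "('d, 'n) monoid_scheme" and B' and h +
  assumes h: "h \<in> hom Z Z'" and h_image: "h ` B \<subseteq> B'"
begin

sublocale N: normal B Z
  by (rule Z.subgroup_imp_normal) (rule B.subgroup_axioms)

sublocale N': normal B' Z'
  by (rule Z'.subgroup_imp_normal) (rule B'.subgroup_axioms)

lemma induced_coset: "c \<in> carrier Z \<Longrightarrow> B' <#>\<^bsub>Z'\<^esub> (h ` (B #>\<^bsub>Z\<^esub> c)) = B' #>\<^bsub>Z'\<^esub> h c"
  by (rule set_mult_image_coset) (auto intro: Z.is_group Z'.is_group B.subgroup_axioms B'.subgroup_axioms h simp: h_image)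

lemma induced_hom: "(\<lambda>\<xi>. B' <#>\<^bsub>Z'\<^esub> (h ` \<xi>)) \<in> hom (Z Mod B) (Z' Mod B')"
proof (rule homI)
  show "B' <#>\<^bsub>Z'\<^esub> (h ` \<xi>) \<in> carrier (Z' Mod B')" if "\<xi> \<in> carrier (Z Mod B)" for \<xi>
    using that h by (auto simp: carrier_FactGroup induced_coset hom_in_carrier)
  fix \<xi> \<zeta> assume "\<xi> \<in> carrier (Z Mod B)" "\<zeta> \<in> carrier (Z Mod B)"
  then obtain c d where "c \<in> carrier Z" "\<xi> = B #>\<^bsub>Z\<^esub> c" "d \<in> carrier Z" "\<zeta> = B #>\<^bsub>Z\<^esub> d"
    by (auto simp: carrier_FactGroup)
  then show "B' <#>\<^bsub>Z'\<^esub> (h ` (\<xi> \<otimes>\<^bsub>Z Mod B\<^esub> \<zeta>)) =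
      (B' <#>\<^bsub>Z'\<^esub> (h ` \<xi>)) \<otimes>\<^bsub>Z' Mod B'\<^esub> (B' <#>\<^bsub>Z'\<^esub> (h ` \<zeta>))"
    using h by (simp add: N.rcos_sum N'.rcos_sum induced_coset hom_mult hom_in_carrier)
qed

text \<open>Turns bijectivity on classes into conditions on representatives, the form in which
  excision can be checked on chains.\<close>

lemma induced_iso:
  assumes surj: "\<And>c. c \<in> carrier Z' \<Longrightarrow> \<exists>z\<in>carrier Z. \<exists>b\<in>B'. c = b \<otimes>\<^bsub>Z'\<^esub> h z"
    and inj: "\<And>z. \<lbrakk>z \<in> carrier Z; h z \<in> B'\<rbrakk> \<Longrightarrow> z \<in> B"
  shows "(\<lambda>\<xi>. B' <#>\<^bsub>Z'\<^esub> (h ` \<xi>)) \<in> iso (Z Mod B) (Z' Mod B')"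
proof -
  interpret group_hom "Z Mod B" "Z' Mod B'" "\<lambda>\<xi>. B' <#>\<^bsub>Z'\<^esub> (h ` \<xi>)"
    by (simp add: group_hom_def group_hom_axioms_def N.factorgroup_is_group N'.factorgroup_is_group induced_hom)
  have hc: "h z \<in> carrier Z'" if "z \<in> carrier Z" for z
    using h that by (rule hom_in_carrier)
  show ?thesis
    unfolding iso_iff
  proof (intro conjI subsetI ballI impI)
    fix \<zeta> assume "\<zeta> \<in> carrier (Z' Mod B')"
    then obtain c where c: "c \<in> carrier Z'" "\<zeta> = B' #>\<^bsub>Z'\<^esub> c"
      by (auto simp: carrier_FactGroup)
    then obtain z b where z: "z \<in> carrier Z" "b \<in> B'" "c = b \<otimes>\<^bsub>Z'\<^esub> h z"
      using surj by blast
    then have "c \<in> B' #>\<^bsub>Z'\<^esub> h z"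
      by (auto simp: r_coset_def)
    then have "B' #>\<^bsub>Z'\<^esub> h z = \<zeta>"
      using Z'.repr_independence[of c B' "h z"] hc z B'.subgroup_axioms c by simp
    then show "\<zeta> \<in> (\<lambda>\<xi>. B' <#>\<^bsub>Z'\<^esub> (h ` \<xi>)) ` carrier (Z Mod B)"
      using z induced_coset by (auto simp: carrier_FactGroup image_iff)
  next
    fix \<xi> assume "\<xi> \<in> carrier (Z Mod B)" and one: "B' <#>\<^bsub>Z'\<^esub> (h ` \<xi>) = \<one>\<^bsub>Z' Mod B'\<^esub>"
    then obtain z where z: "z \<in> carrier Z" "\<xi> = B #>\<^bsub>Z\<^esub> z"
      by (auto simp: carrier_FactGroup)
    then have "B' #>\<^bsub>Z'\<^esub> h z = B'"
      using one by (simp add: induced_coset)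
    then have "h z \<in> B'"
      using Z'.rcos_self[OF hc[OF z(1)] B'.subgroup_axioms] by simp
    then have "z \<in> B" using inj z by simp
    then show "\<xi> = \<one>\<^bsub>Z Mod B\<^esub>"
      using z B.rcos_const Z.is_group by simp
  qed
qed

end

section \<open>Groups of functions\<close>

text \<open>A subgroup of the group of all functions on lists. It is expressed by pointwise closure
  because the inverse in \<open>fun_group C G\<close> formally depends on the carrier
  \<open>C\<close>; \<open>inv_fun_group\<close> identifies it with the pointwise one.\<close>

definition pointwise_subgroup :: "('g, 'm) monoid_scheme \<Rightarrow> ('a list \<Rightarrow> 'g) set \<Rightarrow> bool" where
  "pointwise_subgroup G C \<longleftrightarrow>
     (\<forall>f\<in>C. \<forall>s. f s \<in> carrier G) \<and> (\<lambda>s. \<one>\<^bsub>G\<^esub>) \<in> C \<and>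
     (\<forall>f\<in>C. \<forall>g\<in>C. (\<lambda>s. f s \<otimes>\<^bsub>G\<^esub> g s) \<in> C) \<and> (\<forall>f\<in>C. (\<lambda>s. inv\<^bsub>G\<^esub> f s) \<in> C)"

lemma fun_group_simps [simp]:
  "carrier (fun_group C G) = C"
  "f \<otimes>\<^bsub>fun_group C G\<^esub> g = (\<lambda>s. f s \<otimes>\<^bsub>G\<^esub> g s)"
  "\<one>\<^bsub>fun_group C G\<^esub> = (\<lambda>s. \<one>\<^bsub>G\<^esub>)"
  by (auto simp: fun_group_def)

context comm_group begin

lemma comm_group_fun_group:
  assumes "pointwise_subgroup G C"
  shows "comm_group (fun_group C G)"
proof (rule comm_groupI)
  fix f assume f: "f \<in> carrier (fun_group C G)"
  show "\<exists>g\<in>carrier (fun_group C G). g \<otimes>\<^bsub>fun_group C G\<^esub> f = \<one>\<^bsub>fun_group C G\<^esub>"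
    by (rule bexI[of _ "\<lambda>s. inv f s"]) (use f assms in \<open>auto simp: pointwise_subgroup_def\<close>)
qed (use assms in \<open>auto simp: pointwise_subgroup_def m_assoc m_comm m_lcomm\<close>)

lemma inv_fun_group:
  assumes "pointwise_subgroup G C" "f \<in> C"
  shows "inv\<^bsub>fun_group C G\<^esub> f = (\<lambda>s. inv f s)"
proof -
  interpret C: comm_group "fun_group C G" by (rule comm_group_fun_group) fact
  show ?thesis
    by (rule C.inv_equality) (use assms in \<open>auto simp: pointwise_subgroup_def\<close>)
qed

lemma subgroup_fun_group:
  assumes "pointwise_subgroup G C" "pointwise_subgroup G B" "B \<subseteq> C"
  shows "subgroup B (fun_group C G)"
proof unfold_locales
  fix f assume "f \<in> B"
  then show "inv\<^bsub>fun_group C G\<^esub> f \<in> B"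
    using inv_fun_group[OF assms(1), of f] assms(2,3) by (auto simp: pointwise_subgroup_def)
qed (use assms in \<open>auto simp: pointwise_subgroup_def\<close>)

lemma finprod_int_pow:
  assumes "finite A" "a \<in> A \<rightarrow> carrier G"
  shows "finprod G (\<lambda>i. a i [^] (k::int)) A = finprod G a A [^] k"
  using assms
proof (induction A rule: finite_induct)
  case (insert x A)
  then have a: "a \<in> A \<rightarrow> carrier G" "a x \<in> carrier G" by auto
  have "finprod G (\<lambda>i. a i [^] k) (insert x A) = a x [^] k \<otimes> finprod G (\<lambda>i. a i [^] k) A"
    using insert.hyps a by (intro finprod_insert) auto
  also have "\<dots> = (a x \<otimes> finprod G a A) [^] k"
    using insert a by (simp add: int_pow_distrib)
  finally show ?case using insert.hyps a by simp
qed simp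

text \<open>The cancellation in \<open>boundary_boundary\<close> and
  \<open>coboundary_coboundary\<close>. Adding \<open>v\<close> to \<open>V\<close> adds a row and a
  column whose entries cancel pairwise. The diagonal has its own hypothesis because antisymmetry
  there would only give elements whose square is one.\<close>

lemma finprod_antisymmetric:
  assumes "finite V"
    and closed: "\<And>x y. \<lbrakk>x \<in> V; y \<in> V\<rbrakk> \<Longrightarrow> a x y \<in> carrier G"
    and diag: "\<And>x. x \<in> V \<Longrightarrow> a x x = \<one>"
    and anti: "\<And>x y. \<lbrakk>x \<in> V; y \<in> V; x \<noteq> y\<rbrakk> \<Longrightarrow> a x y \<otimes> a y x = \<one>"
  shows "finprod G (\<lambda>x. finprod G (a x) V) V = \<one>"
  using assms
proof (induction V rule: finite_induct)
  case (insert v V)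
  have c: "a x y \<in> carrier G" if "x \<in> insert v V" "y \<in> insert v V" for x y
    using insert.prems(1) that by blast
  have row: "finprod G (a x) (insert v V) = a x v \<otimes> finprod G (a x) V" if "x \<in> insert v V" for x
    using insert.hyps c that by (intro finprod_insert) auto
  have "finprod G (\<lambda>x. finprod G (a x) (insert v V)) (insert v V) =
      finprod G (a v) (insert v V) \<otimes> finprod G (\<lambda>x. finprod G (a x) (insert v V)) V"
    using insert.hyps c by (intro finprod_insert) (auto intro!: finprod_closed)
  also have "finprod G (\<lambda>x. finprod G (a x) (insert v V)) V = finprod G (\<lambda>x. a x v \<otimes> finprod G (a x) V) V"
    using c row by (intro finprod_cong') (auto intro!: m_closed finprod_closed)
  also have "\<dots> = finprod G (\<lambda>x. a x v) V \<otimes> finprod G (\<lambda>x. finprod G (a x) V) V"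
    using c by (intro finprod_multf) (auto intro!: finprod_closed)
  also have "finprod G (\<lambda>x. finprod G (a x) V) V = \<one>"
    using insert.prems by (intro insert.IH) auto
  also have "finprod G (a v) (insert v V) = finprod G (a v) V"
    using row[of v] insert.prems(2)[of v] c by simp
  also have "finprod G (a v) V \<otimes> (finprod G (\<lambda>x. a x v) V \<otimes> \<one>) = finprod G (\<lambda>x. a v x \<otimes> a x v) V"
    using c by (subst finprod_multf) auto
  also have "\<dots> = \<one>"
    using insert.prems(3) insert.hyps(2) by (intro finprod_one_eqI) auto
  finally show ?case .
qed simp

end

section \<open>Chains and cochains\<close>

definition face_closed :: "'a set set \<Rightarrow> bool" where
  "face_closed K \<longleftrightarrow> (\<forall>s\<in>K. \<forall>t. t \<noteq> {} \<and> t \<subseteq> s \<longrightarrow> t \<in> K)"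

lemma permute_list_ordered_simplices_iff:
  assumes "length s = Suc q" "p permutes {..<Suc q}"
  shows "permute_list p s \<in> ordered_simplices q K \<longleftrightarrow> s \<in> ordered_simplices q K"
  using assms by (simp add: ordered_simplices_def)

lemma ordered_simplices_mono: "L \<subseteq> K \<Longrightarrow> ordered_simplices q L \<subseteq> ordered_simplices q K"
  by (auto simp: ordered_simplices_def)

lemma ordered_simplices_Cons:
  assumes "face_closed K" "x # s \<in> ordered_simplices (Suc q) K"
  shows "s \<in> ordered_simplices q K"
  using assms unfolding face_closed_def ordered_simplices_def
  by (auto dest!: bspec spec[of _ "set s"])

lemma face_ordered_simplices:
  assumes "face_closed K" "s \<in> ordered_simplices (Suc q) K" "i \<le> Suc q"
  shows "face i s \<in> ordered_simplices q K"
proof -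
  have "set (face i s) \<subseteq> set s"
    by (auto simp: face_def dest: in_set_takeD in_set_dropD)
  moreover have len: "length (face i s) = Suc q" "distinct (face i s)"
    using assms by (auto simp: face_def ordered_simplices_def set_take_disj_set_drop_if_distinct)
  moreover have "face i s \<noteq> []"
    using len by auto
  ultimately show ?thesis
    using assms unfolding face_closed_def ordered_simplices_def by auto
qed

text \<open>The boundary of \<open>c\<close> at \<open>s\<close> reads \<open>c\<close> at
  \<open>x # s\<close>, so a permutation of \<open>s\<close> has to be extended to one that fixes
  the first position; the shifted permutation has the same sign.\<close>

lemma cons_permute_list:
  assumes p: "p permutes {..<m}" and s: "length s = m"
  obtains l where "l permutes {..<Suc m}" "sign l = sign p"
    "\<And>x. permute_list l (x # s) = x # permute_list p s"
proof
  define l where "l = map_permutation {..<m} Suc p"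
  have l_perm: "l permutes Suc ` {..<m}"
    unfolding l_def by (intro map_permutation_permutes) (auto simp: bij_betw_def p)
  show l: "l permutes {..<Suc m}"
    by (rule permutes_subset[OF l_perm]) auto
  show "sign l = sign p"
    unfolding l_def by (rule sign_map_permutation) (use p in auto)
  have l0: "l 0 = 0" using l_perm by (auto simp: permutes_def)
  have lS: "l (Suc j) = Suc (p j)" if "j < m" for j
    unfolding l_def using that by (subst map_permutation_apply) auto
  show "permute_list l (x # s) = x # permute_list p s" for x
  proof (rule nth_equalityI)
    fix k assume "k < length (permute_list l (x # s))"
    then show "permute_list l (x # s) ! k = (x # permute_list p s) ! k"
      using l p s by (cases k) (simp_all add: permute_list_nth l0 lS)
  qed simp
qed

lemma permute_list_front_cycle:
  assumes "i < length s"
  shows "permute_list (front_cycle i) s = s ! i # face i s"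
proof (rule nth_equalityI)
  show "length (permute_list (front_cycle i) s) = length (s ! i # face i s)"
    using assms by (simp add: face_def)
  fix k assume "k < length (permute_list (front_cycle i) s)"
  then show "permute_list (front_cycle i) s ! k = (s ! i # face i s) ! k"
    using assms front_cycle_permutes_sign[OF assms]
    by (cases k) (auto simp: permute_list_nth face_def nth_append min_def)
qed

text \<open>Both signs below are read off from the elementary chain of \<open>s\<close> over the integers,
  evaluated at \<open>(s' ! i) # face i s'\<close>, where \<open>s'\<close> is the permuted list.\<close>

lemma face_permute_list:
  assumes s: "distinct s" and p: "p permutes {..<length s}" and i: "i < length s"
  obtains r where "r permutes {..<length s - 1}"
    "face i (permute_list p s) = permute_list r (face (p i) s)"
    "sign r * (-1) ^ p i = sign p * (-1 :: int) ^ i"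
proof -
  interpret \<Z>: comm_group integer_group by (rule abelian_integer_group)
  let ?E = "elementary_chain integer_group"
  define s' where "s' = permute_list p s"
  have pi: "p i < length s" using p i permutes_in_image by fastforce
  have x: "s' ! i = s ! p i" using p i by (simp add: s'_def permute_list_nth)
  have fc: "front_cycle i permutes {..<length s}" "sign (front_cycle i) = (-1) ^ i"
    using front_cycle_permutes_sign[OF i] by auto
  have "mset s' = add_mset (s' ! i) (mset (face i s'))"
    using i permute_list_front_cycle[of i s'] mset_permute_list[of "front_cycle i" s'] fc
    by (simp add: s'_def)
  moreover have "mset s = add_mset (s ! p i) (mset (face (p i) s))"
    using pi permute_list_front_cycle[of "p i" s] mset_permute_list[of "front_cycle (p i)" s]
      front_cycle_permutes_sign[OF pi] by simp
  moreover have "mset s' = mset s" using p by (simp add: s'_def)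
  ultimately have "mset (face i s') = mset (face (p i) s)" using x by simp
  then obtain r where r: "r permutes {..<length (face (p i) s)}" "permute_list r (face (p i) s) = face i s'"
    by (rule mset_eq_permutation)
  have len: "length (face (p i) s) = length s - 1"
    using pi by (simp add: face_def)
  have d: "distinct (face (p i) s)"
    using s by (simp add: face_def set_take_disj_set_drop_if_distinct)
  have "?E 1 s (s' ! i # face i s') = ?E ((-1) ^ p i) (face (p i) s) (face i s')"
    using \<Z>.elementary_chain_face[OF s pi, of 1 "face i s'"] by (simp add: x)
  also have "\<dots> = sign r * (-1) ^ p i"
    using elementary_chain_permute_list[OF d r(1), of integer_group] r(2) by simp
  finally have 1: "?E 1 s (s' ! i # face i s') = sign r * (-1) ^ p i" .
  have "s' ! i # face i s' = permute_list (p \<circ> front_cycle i) s"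
    using permute_list_front_cycle[of i s'] i fc p by (simp add: s'_def permute_list_compose)
  then have "?E 1 s (s' ! i # face i s') = sign (p \<circ> front_cycle i)"
    using elementary_chain_permute_list[OF s permutes_compose[OF fc(1) p], of integer_group 1] by simp
  also have "\<dots> = sign p * (-1) ^ i"
    using p fc by (subst sign_compose) (auto intro: permutes_imp_permutation)
  finally have "sign r * (-1) ^ p i = sign p * (-1 :: int) ^ i" using 1 by simp
  then show thesis using that r len by (simp add: s'_def)
qed

text \<open>Extension by the neutral element preserves antisymmetry because permuting a list does
  not change its vertex set. This is an inclusion of groups only; for cochains it need not commute
  with the coboundary.\<close>

lemma cochains_mono:
  assumes "group G" "L \<subseteq> K"
  shows "cochains q L G \<subseteq> cochains q K G"
proof
  interpret group G by fact
  fix f assume f: "f \<in> cochains q L G"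
  have "f s \<in> carrier G" for s
    using f by (cases "s \<in> ordered_simplices q L") (auto simp: cochains_def)
  moreover have "f (permute_list p s) = f s [^]\<^bsub>G\<^esub> sign p"
    if "s \<in> ordered_simplices q K" "p permutes {..<Suc q}" for s p
  proof (cases "s \<in> ordered_simplices q L")
    case False
    then have "permute_list p s \<notin> ordered_simplices q L"
      using that permute_list_ordered_simplices_iff[of s q p L] by (simp add: ordered_simplices_def)
    then show ?thesis using f False by (simp add: cochains_def)
  qed (use f that in \<open>auto simp: cochains_def\<close>)
  moreover have "f s = \<one>\<^bsub>G\<^esub>" if "s \<notin> ordered_simplices q K" for s
    using f that ordered_simplices_mono[OF assms(2), of q] by (auto simp: cochains_def)
  ultimately show "f \<in> cochains q K G"
    by (simp add: cochains_def)
qed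

lemma chains_mono: "\<lbrakk>group G; L \<subseteq> K\<rbrakk> \<Longrightarrow> chains q L G \<subseteq> chains q K G"
  using cochains_mono[of G L K q] by (auto simp: chains_def)

lemma cochains_Int:
  "\<lbrakk>f \<in> cochains q K G; f \<in> cochains q L G\<rbrakk> \<Longrightarrow> f \<in> cochains q (K \<inter> L) G"
  by (auto simp: cochains_def ordered_simplices_def)

lemma chains_Int:
  "\<lbrakk>f \<in> chains q K G; f \<in> chains q L G\<rbrakk> \<Longrightarrow> f \<in> chains q (K \<inter> L) G"
  by (auto simp: chains_def intro: cochains_Int)

text \<open>Antisymmetry survives because the condition depends on the vertex set alone.\<close>

lemma cochains_restrict:
  assumes "group G" "f \<in> cochains q K G"
  shows "(\<lambda>s. if P (set s) then f s else \<one>\<^bsub>G\<^esub>) \<in> cochains q {t \<in> K. P t} G"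
proof -
  interpret group G by fact
  show ?thesis
    using assms by (auto simp: cochains_def ordered_simplices_def)
qed

lemma chains_restrict:
  assumes "group G" "f \<in> chains q K G"
  shows "(\<lambda>s. if P (set s) then f s else \<one>\<^bsub>G\<^esub>) \<in> chains q {t \<in> K. P t} G"
  using assms cochains_restrict[OF assms(1), of f q K P]
  by (auto simp: chains_def intro: rev_finite_subset)

lemma cochains_empty: "group G \<Longrightarrow> cochains q {} G = {\<lambda>s. \<one>\<^bsub>G\<^esub>}"
  by (auto simp: cochains_def ordered_simplices_def)

context comm_group begin

lemma cochains_closed: "f \<in> cochains q K G \<Longrightarrow> f s \<in> carrier G"
  by (cases "s \<in> ordered_simplices q K") (auto simp: cochains_def)

text \<open>Outside the simplices both sides are one, so only the length of \<open>s\<close>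
  matters.\<close>

lemma cochains_permute:
  "\<lbrakk>f \<in> cochains q K G; length s = Suc q; p permutes {..<Suc q}\<rbrakk>
     \<Longrightarrow> f (permute_list p s) = f s [^] sign p"
  using permute_list_ordered_simplices_iff[of s q p K]
  by (cases "s \<in> ordered_simplices q K") (auto simp: cochains_def)

lemma pointwise_subgroup_cochains: "pointwise_subgroup G (cochains q K G)"
  unfolding pointwise_subgroup_def
proof (intro conjI ballI allI)
  show "f s \<in> carrier G" if "f \<in> cochains q K G" for f s
    using that by (rule cochains_closed)
  show "(\<lambda>s. f s \<otimes> g s) \<in> cochains q K G" if "f \<in> cochains q K G" "g \<in> cochains q K G" for f g
    using that by (auto simp: cochains_def int_pow_distrib)
  show "(\<lambda>s. inv f s) \<in> cochains q K G" if "f \<in> cochains q K G" for f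
    using that by (auto simp: cochains_def int_pow_inv)
qed (auto simp: cochains_def)

lemma pointwise_subgroup_chains: "pointwise_subgroup G (chains q (K :: 'v set set) G)"
proof -
  have fin: "finite {s. f s \<otimes> g s \<noteq> \<one>}"
    if "finite {s. f s \<noteq> \<one>}" "finite {s. g s \<noteq> \<one>}" for f g :: "'v list \<Rightarrow> 'a"
    by (rule finite_subset[of _ "{s. f s \<noteq> \<one>} \<union> {s. g s \<noteq> \<one>}"]) (use that in auto)
  have "finite {s. inv f s \<noteq> \<one>}" if "finite {s. f s \<noteq> \<one>}" for f :: "'v list \<Rightarrow> 'a"
    by (rule finite_subset[OF _ that]) auto
  with fin show ?thesis
    using pointwise_subgroup_cochains[of q K] by (auto simp: pointwise_subgroup_def chains_def)
qed

lemmas chains_mult = pointwise_subgroup_chains[unfolded pointwise_subgroup_def, THEN conjunct2, THEN conjunct2, THEN conjunct1, rule_format]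
lemmas chains_inv = pointwise_subgroup_chains[unfolded pointwise_subgroup_def, THEN conjunct2, THEN conjunct2, THEN conjunct2, rule_format]
lemmas chains_one = pointwise_subgroup_chains[unfolded pointwise_subgroup_def, THEN conjunct2, THEN conjunct1]

lemma chains_closed: "c \<in> chains q K G \<Longrightarrow> c s \<in> carrier G"
  using cochains_closed[of c q K s] by (simp add: chains_def)

section \<open>The boundary operator\<close>

lemma finite_cons_support:
  "c \<in> chains q K G \<Longrightarrow> finite {x. c (x # s) \<noteq> \<one>}"
  using finite_vimageI[of "{s. c s \<noteq> \<one>}" "\<lambda>x. x # s"] by (auto simp: chains_def vimage_def inj_on_def)

text \<open>The index set in the definition depends on the chain and the list; an arbitrary finite
  superset allows several of them to share one.\<close>

lemma boundary_eq_finprod: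
  assumes "c \<in> chains q K G" "s \<noteq> []" "finite T" "{x. c (x # s) \<noteq> \<one>} \<subseteq> T"
  shows "boundary G c s = finprod G (\<lambda>x. c (x # s)) T"
proof -
  have "finprod G (\<lambda>x. c (x # s)) {x. c (x # s) \<noteq> \<one>} = finprod G (\<lambda>x. c (x # s)) T"
    by (rule finprod_mono_neutral_cong_left) (use assms in \<open>auto intro: chains_closed\<close>)
  then show ?thesis
    using assms(2) by (simp add: boundary_def)
qed

lemma boundary_closed:
  assumes "c \<in> chains q K G"
  shows "boundary G c s \<in> carrier G"
  by (auto simp: boundary_def intro!: finprod_closed chains_closed[OF assms])

lemma boundary_one: "boundary G (\<lambda>s. \<one>) = (\<lambda>s. \<one>)"
  by (auto simp: boundary_def)

lemma boundary_mult:
  assumes "c \<in> chains q K G" "d \<in> chains q K G"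
  shows "boundary G (\<lambda>s. c s \<otimes> d s) = (\<lambda>s. boundary G c s \<otimes> boundary G d s)"
proof
  fix s show "boundary G (\<lambda>s. c s \<otimes> d s) s = boundary G c s \<otimes> boundary G d s"
  proof (cases "s = []")
    case False
    define T where "T = {x. c (x # s) \<noteq> \<one>} \<union> {x. d (x # s) \<noteq> \<one>}"
    have T: "finite T" using assms by (simp add: T_def finite_cons_support)
    have "boundary G (\<lambda>s. c s \<otimes> d s) s = finprod G (\<lambda>x. c (x # s) \<otimes> d (x # s)) T"
      using T False by (intro boundary_eq_finprod[OF chains_mult[OF assms]]) (auto simp: T_def)
    also have "\<dots> = finprod G (\<lambda>x. c (x # s)) T \<otimes> finprod G (\<lambda>x. d (x # s)) T"
      using assms by (intro finprod_multf) (auto intro: chains_closed)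
    also have "\<dots> = boundary G c s \<otimes> boundary G d s"
      using T False by (subst (1 2) boundary_eq_finprod[OF _ _ T]) (auto simp: T_def intro: assms)
    finally show ?thesis .
  qed (simp add: boundary_def)
qed

lemma boundary_inv:
  assumes "c \<in> chains q K G"
  shows "boundary G (\<lambda>s. inv c s) = (\<lambda>s. inv boundary G c s)"
proof
  fix s
  have "(\<lambda>s. inv c s \<otimes> c s) = (\<lambda>s. \<one>)"
    using assms by (simp add: chains_closed)
  then have "boundary G (\<lambda>s. inv c s) s \<otimes> boundary G c s = \<one>"
    using boundary_mult[OF chains_inv[OF assms] assms] by (metis boundary_one)
  then show "boundary G (\<lambda>s. inv c s) s = inv boundary G c s"
    using assms by (intro inv_equality[symmetric]) (auto intro: boundary_closed chains_inv)
qed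

text \<open>For nonempty \<open>s\<close> the list \<open>x # s\<close> is too long to be a vertex;
  the empty list is excluded by definition.\<close>

lemma boundary_chains_0:
  assumes "c \<in> chains 0 K G"
  shows "boundary G c = (\<lambda>s. \<one>)"
proof
  fix s
  have "c (x # s) = \<one>" if "s \<noteq> []" for x
    using assms that by (auto simp: chains_def cochains_def ordered_simplices_def)
  then show "boundary G c s = \<one>" by (simp add: boundary_def)
qed

lemma boundary_chains:
  assumes "face_closed K" and c: "c \<in> chains (Suc q) K G"
  shows "boundary G c \<in> chains q K G"
proof -
  have supp: "\<exists>x. c (x # s) \<noteq> \<one>" if "boundary G c s \<noteq> \<one>" for s
  proof (rule ccontr)
    assume "\<nexists>x. c (x # s) \<noteq> \<one>"
    then have "boundary G c s = \<one>" by (simp add: boundary_def)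
    then show False using that by simp
  qed
  \<comment> \<open>A nontrivial coefficient at \<open>s\<close> needs some \<open>x # s\<close> in
    the support of \<open>c\<close>, and \<open>s\<close> is its tail.\<close>
  have "{s. boundary G c s \<noteq> \<one>} \<subseteq> tl ` {s. c s \<noteq> \<one>}"
    using supp by (force simp: image_iff)
  then have "finite {s. boundary G c s \<noteq> \<one>}"
    using c by (auto simp: chains_def intro: finite_surj)
  moreover have "boundary G c s = \<one>" if "s \<notin> ordered_simplices q K" for s
  proof (rule ccontr)
    assume "boundary G c s \<noteq> \<one>"
    then obtain x where "c (x # s) \<noteq> \<one>" using supp by blast
    then have "x # s \<in> ordered_simplices (Suc q) K"
      using c by (auto simp: chains_def cochains_def)
    then show False using ordered_simplices_Cons assms(1) that by metis
  qed
  moreover have "boundary G c (permute_list p s) = boundary G c s [^] sign p"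
    if s: "s \<in> ordered_simplices q K" and p: "p permutes {..<Suc q}" for s p
  proof -
    have len: "length s = Suc q" using s by (simp add: ordered_simplices_def)
    obtain l where l: "l permutes {..<Suc (Suc q)}" "sign l = sign p"
      "\<And>x. permute_list l (x # s) = x # permute_list p s"
      using cons_permute_list[OF p len] by metis
    have cl: "c (x # permute_list p s) = c (x # s) [^] sign p" for x
      using cochains_permute[of c "Suc q" K "x # s" l] c l len by (simp add: chains_def)
    define T where "T = {x. c (x # s) \<noteq> \<one>}"
    have T: "finite T" unfolding T_def by (rule finite_cons_support[OF c])
    have "permute_list p s \<noteq> []" "s \<noteq> []"
      using len by (auto simp flip: length_0_conv)
    have "boundary G c (permute_list p s) = finprod G (\<lambda>x. c (x # permute_list p s)) T"
      by (rule boundary_eq_finprod[OF c]) (use T \<open>permute_list p s \<noteq> []\<close> in \<open>auto simp: T_def cl\<close>)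
    also have "\<dots> = finprod G (\<lambda>x. c (x # s)) T [^] sign p"
      unfolding cl using T by (intro finprod_int_pow) (auto intro: chains_closed[OF c])
    also have "finprod G (\<lambda>x. c (x # s)) T = boundary G c s"
      using \<open>s \<noteq> []\<close> T by (intro boundary_eq_finprod[OF c, symmetric]) (auto simp: T_def)
    finally show ?thesis .
  qed
  ultimately show ?thesis
    using boundary_closed[OF c] by (auto simp: chains_def cochains_def)
qed

text \<open>The coefficient at \<open>s\<close> is a double product of the values
  \<open>c (y # x # s)\<close>. Exchanging \<open>x\<close> and \<open>y\<close> is an odd
  permutation, and for \<open>x = y\<close> the list is not distinct.\<close>

lemma boundary_boundary:
  assumes K: "face_closed K" and c: "c \<in> chains (Suc q) K G"
  shows "boundary G (boundary G c) = (\<lambda>s. \<one>)"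
proof
  fix s show "boundary G (boundary G c) s = \<one>"
  proof (cases "s = []")
    case False
    \<comment> \<open>All vertices in the support of \<open>c\<close>: both products then run over
      the same set, as the cancellation requires.\<close>
    define T where "T = \<Union> (set ` {s. c s \<noteq> \<one>})"
    have T: "finite T" using c by (auto simp: T_def chains_def)
    have in_T: "x \<in> T" "y \<in> T" if "c (y # x # s) \<noteq> \<one>" for x y
      using that by (force simp: T_def)+
    have inner: "boundary G c (x # s) = finprod G (\<lambda>y. c (y # x # s)) T" for x
      by (rule boundary_eq_finprod[OF c]) (use T in_T in auto)
    have "{x. boundary G c (x # s) \<noteq> \<one>} \<subseteq> T"
    proof
      fix x assume "x \<in> {x. boundary G c (x # s) \<noteq> \<one>}"
      then obtain y where "c (y # x # s) \<noteq> \<one>"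
        using finprod_one_eqI[of T "\<lambda>y. c (y # x # s)"] by (auto simp: inner)
      then show "x \<in> T" by (rule in_T)
    qed
    then have "boundary G (boundary G c) s = finprod G (\<lambda>x. boundary G c (x # s)) T"
      by (intro boundary_eq_finprod[OF boundary_chains[OF K c]] False T)
    also have "\<dots> = finprod G (\<lambda>x. finprod G (\<lambda>y. c (y # x # s)) T) T"
      by (simp add: inner)
    also have "\<dots> = \<one>"
    proof (rule finprod_antisymmetric[OF T])
      show "c (y # x # s) \<in> carrier G" for x y by (rule chains_closed[OF c])
      show "c (x # x # s) = \<one>" for x
        using c by (simp add: chains_def cochains_def ordered_simplices_def)
      show "c (y # x # s) \<otimes> c (x # y # s) = \<one>" for x y
      \<comment> \<open>For any other length both lists lie outside the simplices.\<close>
      proof (cases "length s = q")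
        case True
        let ?t = "Transposition.transpose 0 (Suc 0)"
        have t: "?t permutes {..<Suc (Suc q)}"
          by (rule permutes_swap_id) auto
        have "permute_list ?t (x # y # s) = y # x # s"
        proof (rule nth_equalityI)
          fix k assume "k < length (permute_list ?t (x # y # s))"
          then show "permute_list ?t (x # y # s) ! k = (y # x # s) ! k"
            using t True by (auto simp: permute_list_nth Transposition.transpose_def nth_Cons split: nat.splits)
        qed simp
        moreover have "sign ?t = -1" by (simp add: sign_swap_id)
        ultimately have "c (y # x # s) = c (x # y # s) [^] (-1 :: int)"
          using cochains_permute[of c "Suc q" K "x # y # s" ?t] c t True by (simp add: chains_def)
        then show ?thesis
          using chains_closed[OF c] by (simp add: int_pow_neg)
      next
        case False
        then show ?thesis using c by (simp add: chains_def cochains_def ordered_simplices_def)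
      qed
    qed
    finally show ?thesis .
  qed (simp add: boundary_def)
qed

section \<open>The coboundary operator\<close>

lemma coboundary_closed:
  assumes "f \<in> cochains q K G"
  shows "coboundary q K G f s \<in> carrier G"
  by (auto simp: coboundary_def intro!: finprod_closed int_pow_closed cochains_closed[OF assms])

lemma coboundary_mult:
  assumes "f \<in> cochains q K G" "g \<in> cochains q K G"
  shows "coboundary q K G (\<lambda>s. f s \<otimes> g s) = (\<lambda>s. coboundary q K G f s \<otimes> coboundary q K G g s)"
proof
  fix s
  have "finprod G (\<lambda>i. (f (face i s) \<otimes> g (face i s)) [^] ((-1) ^ i :: int)) {..Suc q} =
      finprod G (\<lambda>i. f (face i s) [^] ((-1) ^ i :: int) \<otimes> g (face i s) [^] ((-1) ^ i :: int)) {..Suc q}"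
    using assms by (intro finprod_cong') (auto simp: int_pow_distrib cochains_closed[OF assms(1)] cochains_closed[OF assms(2)])
  also have "\<dots> = finprod G (\<lambda>i. f (face i s) [^] ((-1) ^ i :: int)) {..Suc q}
      \<otimes> finprod G (\<lambda>i. g (face i s) [^] ((-1) ^ i :: int)) {..Suc q}"
    by (intro finprod_multf) (auto intro: cochains_closed[OF assms(1)] cochains_closed[OF assms(2)])
  finally show "coboundary q K G (\<lambda>s. f s \<otimes> g s) s = coboundary q K G f s \<otimes> coboundary q K G g s"
    by (simp add: coboundary_def)
qed

lemma coboundary_one: "coboundary q K G (\<lambda>s. \<one>) = (\<lambda>s. \<one>)"
  by (auto simp: coboundary_def fun_eq_iff intro!: finprod_one_eqI)

lemma coboundary_inv:
  assumes "f \<in> cochains q K G"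
  shows "coboundary q K G (\<lambda>s. inv f s) = (\<lambda>s. inv coboundary q K G f s)"
proof
  fix s
  have inv: "(\<lambda>s. inv f s) \<in> cochains q K G"
    using pointwise_subgroup_cochains[of q K] assms by (simp add: pointwise_subgroup_def)
  have "(\<lambda>s. inv f s \<otimes> f s) = (\<lambda>s. \<one>)"
    using assms by (simp add: cochains_closed)
  then have "coboundary q K G (\<lambda>s. inv f s) s \<otimes> coboundary q K G f s = \<one>"
    using coboundary_mult[OF inv assms] by (metis coboundary_one)
  then show "coboundary q K G (\<lambda>s. inv f s) s = inv coboundary q K G f s"
    using assms inv by (intro inv_equality[symmetric]) (auto intro: coboundary_closed)
qed

text \<open>Permuting a simplex by \<open>p\<close> also permutes its faces: the factor at
  \<open>i\<close> becomes the factor at \<open>p i\<close> raised to \<open>sign p\<close>, where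
  the sign rule of \<open>face_permute_list\<close> absorbs the reordering inside the face.
  Reindexing by \<open>p\<close> then gives antisymmetry.\<close>

lemma coboundary_cochains:
  assumes K: "face_closed K" and f: "f \<in> cochains q K G"
  shows "coboundary q K G f \<in> cochains (Suc q) K G"
proof -
  have "coboundary q K G f (permute_list p s) = coboundary q K G f s [^] sign p"
    if s: "s \<in> ordered_simplices (Suc q) K" and p: "p permutes {..<Suc (Suc q)}" for s p
  proof -
    have len: "length s = Suc (Suc q)" "distinct s" using s by (auto simp: ordered_simplices_def)
    let ?a = "\<lambda>i. f (face i s) [^] ((-1) ^ i :: int)"
    have summand: "f (face i (permute_list p s)) [^] ((-1) ^ i :: int) = ?a (p i) [^] sign p"
      if i: "i \<le> Suc q" for i
    proof -
      obtain r where r: "r permutes {..<length s - 1}"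
        "face i (permute_list p s) = permute_list r (face (p i) s)"
        "sign r * (-1) ^ p i = sign p * (-1 :: int) ^ i"
        using face_permute_list[of s p i] len p i by (metis le_imp_less_Suc)
      have "p i < length s" using p i len permutes_in_image[OF p, of i] by simp
      then have "length (face (p i) s) = Suc q" using len by (simp add: face_def)
      then have "f (face i (permute_list p s)) = f (face (p i) s) [^] sign r"
        using cochains_permute[OF f] r len by simp
      then have "f (face i (permute_list p s)) [^] ((-1) ^ i :: int) = f (face (p i) s) [^] (sign r * (-1) ^ i)"
        using f by (simp add: int_pow_pow cochains_closed)
      \<comment> \<open>The sign rule is multiplied by \<open>(-1) ^ p i * (-1) ^ i\<close>, and
        squares of signs are one.\<close>
      also have "sign r * (-1) ^ i = (-1) ^ p i * sign p"
      proof -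
        have "sign r * (-1) ^ i = (sign r * (-1) ^ p i) * (-1) ^ p i * (-1 :: int) ^ i"
          by (simp add: mult.assoc flip: power_mult_distrib)
        also have "\<dots> = sign p * (-1) ^ p i * ((-1) ^ i * (-1 :: int) ^ i)"
          unfolding r(3) by (simp add: ac_simps)
        also have "\<dots> = (-1) ^ p i * sign p"
          by (simp flip: power_mult_distrib)
        finally show ?thesis .
      qed
      finally show ?thesis
        using f by (simp add: int_pow_pow cochains_closed)
    qed
    have "coboundary q K G f (permute_list p s) =
        finprod G (\<lambda>i. f (face i (permute_list p s)) [^] ((-1) ^ i :: int)) {..Suc q}"
      using s p len by (simp add: coboundary_def permute_list_ordered_simplices_iff)
    also have "\<dots> = finprod G (\<lambda>i. ?a (p i) [^] sign p) {..Suc q}"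
      using f summand by (intro finprod_cong') (auto intro: cochains_closed)
    also have "\<dots> = finprod G (\<lambda>i. ?a (p i)) {..Suc q} [^] sign p"
      using f by (intro finprod_int_pow) (auto intro: cochains_closed)
    also have "finprod G (\<lambda>i. ?a (p i)) {..Suc q} = finprod G ?a (p ` {..Suc q})"
      using f p by (intro finprod_reindex[symmetric]) (auto intro: cochains_closed inj_on_subset[OF permutes_inj])
    also have "p ` {..Suc q} = {..Suc q}"
      using permutes_image[OF p] by (simp add: lessThan_Suc_atMost)
    finally show ?thesis using s by (simp add: coboundary_def)
  qed
  moreover have "coboundary q K G f s = \<one>" if "s \<notin> ordered_simplices (Suc q) K" for s
    using that by (simp add: coboundary_def)
  ultimately show ?thesis
    using coboundary_closed[OF f] by (simp add: cochains_def)
qed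

end

text \<open>The simplicial identity: once entry \<open>i\<close> is gone, entry \<open>k\<close> of
  \<open>s\<close> sits at position \<open>k - 1\<close>.\<close>

lemma face_face:
  assumes "i < k" "k < length s"
  shows "face (k - 1) (face i s) = face i (face k s)"
proof -
  have nth: "face j xs ! l = xs ! (if l < j then l else Suc l)" if "j < length xs" "l < length xs - 1"
    for j l and xs :: "'a list"
    using that by (auto simp: face_def nth_append min_def)
  have len: "length (face j xs) = length xs - 1" if "j < length xs" for j and xs :: "'a list"
    using that by (auto simp: face_def)
  show ?thesis
    by (rule nth_equalityI) (use assms in \<open>auto simp: nth len\<close>)
qed

context comm_group begin

lemma coboundary_coboundary:
  assumes K: "face_closed K" and f: "f \<in> cochains q K G"
  shows "coboundary (Suc q) K G (coboundary q K G f) = (\<lambda>s. \<one>)"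
proof
  fix s show "coboundary (Suc q) K G (coboundary q K G f) s = \<one>"
  proof (cases "s \<in> ordered_simplices (Suc (Suc q)) K")
    case True
    then have len: "length s = Suc (Suc (Suc q))" by (simp add: ordered_simplices_def)
    define V where "V = {..Suc (Suc q)}"
    \<comment> \<open>\<open>m i k\<close> is the position of entry \<open>k\<close> of
      \<open>s\<close> after entry \<open>i\<close> has been deleted. Indexing the factors by the
      two original positions makes them a square array with neutral diagonal, in which exchanging
      \<open>i\<close> and \<open>k\<close> reverses the order of deletion.\<close>
    define m where "m i k = (if k < i then k else k - 1)" for i k :: nat
    define a where "a i k = (if k = i then \<one> else f (face (m i k) (face i s)) [^] ((-1) ^ m i k * (-1) ^ i :: int))" for i k
    have a: "a i k \<in> carrier G" for i k
      by (auto simp: a_def intro!: cochains_closed[OF f])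
    have outer: "coboundary q K G f (face i s) [^] ((-1) ^ i :: int) = finprod G (a i) V" if i: "i \<in> V" for i
    proof -
      \<comment> \<open>Inverse to \<open>m i\<close>: the original position of entry
        \<open>j\<close> of the face.\<close>
      define g where "g j = (if j < i then j else Suc j)" for j
      have mg: "m i (g j) = j" "g j \<noteq> i" for j by (auto simp: g_def m_def)
      have g: "V - {i} = g ` {..Suc q}"
      proof (intro equalityI subsetI)
        fix k assume "k \<in> V - {i}"
        then have "k = g (m i k)" "m i k \<in> {..Suc q}"
          using i by (auto simp: V_def g_def m_def)
        then show "k \<in> g ` {..Suc q}" by blast
      qed (use i in \<open>auto simp: V_def g_def split: if_splits\<close>)
      have "inj_on g {..Suc q}" by (auto simp: inj_on_def g_def split: if_splits)
      have "finprod G (a i) V = finprod G (a i) (V - {i})"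
        by (rule finprod_mono_neutral_cong_right) (auto simp: V_def a, simp add: a_def)
      also have "\<dots> = finprod G (\<lambda>j. a i (g j)) {..Suc q}"
        unfolding g by (rule finprod_reindex) (use a \<open>inj_on g {..Suc q}\<close> in auto)
      also have "\<dots> = finprod G (\<lambda>j. (f (face j (face i s)) [^] ((-1) ^ j :: int)) [^] ((-1) ^ i :: int)) {..Suc q}"
        by (intro finprod_cong') (auto simp: a_def mg int_pow_pow cochains_closed[OF f])
      also have "\<dots> = finprod G (\<lambda>j. f (face j (face i s)) [^] ((-1) ^ j :: int)) {..Suc q} [^] ((-1) ^ i :: int)"
        by (intro finprod_int_pow) (auto simp: cochains_closed[OF f])
      also have "finprod G (\<lambda>j. f (face j (face i s)) [^] ((-1) ^ j :: int)) {..Suc q} = coboundary q K G f (face i s)"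
        using face_ordered_simplices[OF K True, of i] i by (simp add: V_def coboundary_def)
      finally show ?thesis ..
    qed
    have anti: "a i k \<otimes> a k i = \<one>" if ik: "i \<in> V" "k \<in> V" "i < k" for i k
    proof -
      have eq: "face (m i k) (face i s) = face (m k i) (face k s)"
        using face_face[of i k s] ik len by (simp add: m_def V_def)
      \<comment> \<open>Here \<open>m i k\<close> is \<open>k - 1\<close> while \<open>m k i\<close>
        is \<open>i\<close>, so the total exponents differ by one.\<close>
      have sgn: "(-1) ^ m i k * (-1) ^ i = - ((-1) ^ m k i * (-1 :: int) ^ k)"
        using ik by (cases k) (simp_all add: m_def)
      have c: "f (face (m k i) (face k s)) \<in> carrier G"
        by (rule cochains_closed[OF f])
      show ?thesis
        using ik c by (simp add: a_def eq sgn int_pow_neg)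
    qed
    have "coboundary (Suc q) K G (coboundary q K G f) s = finprod G (\<lambda>i. finprod G (a i) V) V"
    proof -
      have "finprod G (\<lambda>i. coboundary q K G f (face i s) [^] ((-1) ^ i :: int)) V = finprod G (\<lambda>i. finprod G (a i) V) V"
        by (rule finprod_cong') (auto simp: outer a intro: finprod_closed)
      then show ?thesis
        using True by (simp only: coboundary_def[of "Suc q"] V_def if_True)
    qed
    also have "\<dots> = \<one>"
    proof (rule finprod_antisymmetric)
      show "a i k \<otimes> a k i = \<one>" if "i \<in> V" "k \<in> V" "i \<noteq> k" for i k
        using anti[of i k] anti[of k i] that a by (metis m_comm nat_neq_iff)
    qed (auto simp: V_def a, simp add: a_def)
    finally show ?thesis .
  qed (simp add: coboundary_def)
qed

end

lemma face_closed_Int: "\<lbrakk>face_closed K; face_closed L\<rbrakk> \<Longrightarrow> face_closed (K \<inter> L)"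
  unfolding face_closed_def by (metis Int_iff)

lemma face_closed_Un: "\<lbrakk>face_closed K; face_closed L\<rbrakk> \<Longrightarrow> face_closed (K \<union> L)"
  unfolding face_closed_def by (metis Un_iff)

definition simplicial_pair :: "'a set set \<Rightarrow> 'a set set \<Rightarrow> bool" where
  "simplicial_pair K L \<longleftrightarrow> face_closed K \<and> face_closed L \<and> L \<subseteq> K"

section \<open>Homology of pairs\<close>

context comm_group begin

text \<open>The form with \<open>q - 1\<close> that occurs in \<open>relcycles\<close>; for
  \<open>q = 0\<close> the boundary is neutral and lies in every chain group.\<close>

lemma boundary_chains_pred:
  assumes "face_closed K" "c \<in> chains q K G"
  shows "boundary G c \<in> chains (q - 1) K G"
proof (cases q)
  case 0
  then show ?thesis using assms(2) by (simp add: boundary_chains_0 chains_one)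
next
  case (Suc r)
  then show ?thesis using assms by (simp add: boundary_chains)
qed

lemma pointwise_subgroup_relcycles: "pointwise_subgroup G (relcycles q K L G)"
  unfolding pointwise_subgroup_def relcycles_def
  by (auto simp: chains_closed chains_one boundary_one boundary_mult boundary_inv chains_mult chains_inv)

lemma relboundariesI:
  assumes "d \<in> chains (Suc q) K G" "e \<in> chains q L G" "\<And>s. f s = boundary G d s \<otimes> e s"
  shows "f \<in> relboundaries q K L G"
proof -
  have "f = (\<lambda>s. boundary G d s \<otimes> e s)" using assms(3) by (rule ext)
  then show ?thesis
    unfolding relboundaries_def mem_Collect_eq using assms(1,2) by metis
qed

lemma relboundariesE:
  assumes "f \<in> relboundaries q K L G"
  obtains d e where "d \<in> chains (Suc q) K G" "e \<in> chains q L G" "f = (\<lambda>s. boundary G d s \<otimes> e s)"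
  using assms unfolding relboundaries_def by auto

lemma pointwise_subgroup_relboundaries: "pointwise_subgroup G (relboundaries q K L G)"
  unfolding pointwise_subgroup_def
proof (intro conjI ballI allI)
  fix f assume "f \<in> relboundaries q K L G"
  then obtain d e where f: "f = (\<lambda>s. boundary G d s \<otimes> e s)" "d \<in> chains (Suc q) K G" "e \<in> chains q L G"
    by (rule relboundariesE)
  show "f s \<in> carrier G" for s
    using f by (simp add: boundary_closed chains_closed)
  have "inv f s = boundary G (\<lambda>s. inv d s) s \<otimes> inv e s" for s
    using boundary_closed[OF f(2), of s] chains_closed[OF f(3), of s]
    by (simp add: f(1) boundary_inv[OF f(2)] inv_mult)
  then show "(\<lambda>s. inv f s) \<in> relboundaries q K L G"
    by (rule relboundariesI[OF chains_inv[OF f(2)] chains_inv[OF f(3)]])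
  fix g assume "g \<in> relboundaries q K L G"
  then obtain d' e' where g: "g = (\<lambda>s. boundary G d' s \<otimes> e' s)" "d' \<in> chains (Suc q) K G" "e' \<in> chains q L G"
    by (rule relboundariesE)
  have "f s \<otimes> g s = boundary G (\<lambda>s. d s \<otimes> d' s) s \<otimes> (e s \<otimes> e' s)" for s
    using f g boundary_closed[OF f(2)] boundary_closed[OF g(2)] chains_closed[OF f(3)] chains_closed[OF g(3)]
    by (simp add: f(1) g(1) boundary_mult[OF f(2) g(2)] m_ac)
  then show "(\<lambda>s. f s \<otimes> g s) \<in> relboundaries q K L G"
    by (rule relboundariesI[OF chains_mult[OF f(2) g(2)] chains_mult[OF f(3) g(3)]])
next
  show "(\<lambda>s. \<one>) \<in> relboundaries q K L G"
    by (rule relboundariesI[OF chains_one chains_one]) (simp add: boundary_one)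
qed

lemma relboundaries_subset:
  assumes "simplicial_pair K L"
  shows "relboundaries q K L G \<subseteq> relcycles q K L G"
proof
  fix f assume "f \<in> relboundaries q K L G"
  then obtain d e where f: "f = (\<lambda>s. boundary G d s \<otimes> e s)" "d \<in> chains (Suc q) K G" "e \<in> chains q L G"
    by (rule relboundariesE)
  have K: "face_closed K" "face_closed L" "L \<subseteq> K"
    using assms by (auto simp: simplicial_pair_def)
  have d: "boundary G d \<in> chains q K G"
    using K f by (simp add: boundary_chains)
  have e: "e \<in> chains q K G"
    using chains_mono[OF is_group K(3)] f by blast
  have "boundary G f = boundary G e"
    unfolding f boundary_mult[OF d e] boundary_boundary[OF K(1) f(2)] using e by (simp add: boundary_closed)
  then show "f \<in> relcycles q K L G"
    using boundary_chains_pred[OF K(2) f(3)] chains_mult[OF d e] f by (simp add: relcycles_def)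
qed

lemma subgroup_relboundaries:
  "simplicial_pair K L \<Longrightarrow> subgroup (relboundaries q K L G) (fun_group (relcycles q K L G) G)"
  by (intro subgroup_fun_group pointwise_subgroup_relcycles pointwise_subgroup_relboundaries relboundaries_subset)

lemma comm_group_simplicial_homology:
  "simplicial_pair K L \<Longrightarrow> comm_group (simplicial_homology q K L G)"
  unfolding simplicial_homology_def
  by (intro comm_group.abelian_FactGroup comm_group_fun_group pointwise_subgroup_relcycles subgroup_relboundaries)

lemma relcycles_mono: "\<lbrakk>K \<subseteq> K'; L \<subseteq> L'\<rbrakk> \<Longrightarrow> relcycles q K L G \<subseteq> relcycles q K' L' G"
  using chains_mono[OF is_group, of K K' q] chains_mono[OF is_group, of L L' "q - 1"]
  by (auto simp: relcycles_def)

lemma relboundaries_mono: "\<lbrakk>K \<subseteq> K'; L \<subseteq> L'\<rbrakk> \<Longrightarrow> relboundaries q K L G \<subseteq> relboundaries q K' L' G"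
  using chains_mono[OF is_group, of K K' "Suc q"] chains_mono[OF is_group, of L L' q]
  by (blast elim: relboundariesE intro: relboundariesI)

lemma homology_quotient_map:
  assumes "simplicial_pair K L" "simplicial_pair K' L'" "K \<subseteq> K'" "L \<subseteq> L'"
  shows "quotient_map (fun_group (relcycles q K L G) G) (relboundaries q K L G)
           (fun_group (relcycles q K' L' G) G) (relboundaries q K' L' G) id"
  unfolding quotient_map_def quotient_map_axioms_def
  using assms relcycles_mono[of K K' L L' q] relboundaries_mono[of K K' L L' q]
  by (auto intro!: comm_group_fun_group pointwise_subgroup_relcycles subgroup_relboundaries simp: hom_def)

lemma homology_inclusion_coset:
  assumes "simplicial_pair K L" "simplicial_pair K' L'" "K \<subseteq> K'" "L \<subseteq> L'" "c \<in> relcycles q K L G"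
  shows "homology_inclusion q K' L' G (relboundaries q K L G #>\<^bsub>fun_group (relcycles q K L G) G\<^esub> c)
       = relboundaries q K' L' G #>\<^bsub>fun_group (relcycles q K' L' G) G\<^esub> c"
  using quotient_map.induced_coset[OF homology_quotient_map[OF assms(1-4), of q], of c] assms(5)
  by (simp add: homology_inclusion_def)

lemma homology_inclusion_hom:
  assumes "simplicial_pair K L" "simplicial_pair K' L'" "K \<subseteq> K'" "L \<subseteq> L'"
  shows "homology_inclusion q K' L' G \<in> hom (simplicial_homology q K L G) (simplicial_homology q K' L' G)"
  using quotient_map.induced_hom[OF homology_quotient_map[OF assms, of q]]
  by (simp add: homology_inclusion_def[abs_def] simplicial_homology_def)

lemma homology_inclusion_comp:
  assumes "simplicial_pair K L" "simplicial_pair K' L'" "simplicial_pair K'' L''"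
    and sub: "K \<subseteq> K'" "L \<subseteq> L'" "K' \<subseteq> K''" "L' \<subseteq> L''"
    and "\<xi> \<in> carrier (simplicial_homology q K L G)"
  shows "homology_inclusion q K'' L'' G (homology_inclusion q K' L' G \<xi>) = homology_inclusion q K'' L'' G \<xi>"
proof -
  obtain c where c: "c \<in> relcycles q K L G"
    "\<xi> = relboundaries q K L G #>\<^bsub>fun_group (relcycles q K L G) G\<^esub> c"
    using assms by (auto simp: simplicial_homology_def carrier_FactGroup)
  have c': "c \<in> relcycles q K' L' G"
    using c relcycles_mono sub by blast
  have "K \<subseteq> K''" "L \<subseteq> L''" using sub by auto
  then show ?thesis
    using assms c c' by (simp add: homology_inclusion_coset)
qed

text \<open>Excision already holds for chains: a chain of \<open>K' \<union> L\<close> is the product of its restriction to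
  \<open>L\<close> and a chain of \<open>K'\<close>.\<close>

lemma chains_split:
  assumes "c \<in> chains q (K' \<union> L) G"
  obtains c' l where "c' \<in> chains q K' G" "l \<in> chains q L G" "c = (\<lambda>s. c' s \<otimes> l s)"
proof
  let ?c' = "\<lambda>s. if set s \<notin> L then c s else \<one>" and ?l = "\<lambda>s. if set s \<in> L then c s else \<one>"
  have "?c' \<in> chains q {t \<in> K' \<union> L. t \<notin> L} G"
    by (rule chains_restrict[OF is_group assms, of "\<lambda>t. t \<notin> L"])
  then show "?c' \<in> chains q K' G"
    using chains_mono[OF is_group, of "{t \<in> K' \<union> L. t \<notin> L}" K' q] by auto
  have "?l \<in> chains q {t \<in> K' \<union> L. t \<in> L} G"
    by (rule chains_restrict[OF is_group assms, of "\<lambda>t. t \<in> L"])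
  then show "?l \<in> chains q L G"
    using chains_mono[OF is_group, of "{t \<in> K' \<union> L. t \<in> L}" L q] by auto
  show "c = (\<lambda>s. ?c' s \<otimes> ?l s)"
    using assms by (auto simp: chains_closed fun_eq_iff)
qed

text \<open>Both conditions of \<open>induced_iso\<close> follow by splitting. A relative cycle of
  the large pair is corrected by its part in \<open>L\<close>, which is a relative boundary; for a
  bounding chain, the part in \<open>L\<close> is moved into the error term. In each case the chain
  in question is seen to lie in both \<open>K'\<close> and \<open>L\<close>, hence in the
  intersection.\<close>

lemma homology_excision:
  assumes K': "face_closed K'" and L: "face_closed L"
  shows "homology_inclusion q (K' \<union> L) L G \<in>
    iso (simplicial_homology q K' (K' \<inter> L) G) (simplicial_homology q (K' \<union> L) L G)"
proof -
  have pairs: "simplicial_pair K' (K' \<inter> L)" "simplicial_pair (K' \<union> L) L"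
    using assms by (simp_all add: simplicial_pair_def face_closed_Int face_closed_Un)
  interpret quotient_map "fun_group (relcycles q K' (K' \<inter> L) G) G" "relboundaries q K' (K' \<inter> L) G"
    "fun_group (relcycles q (K' \<union> L) L G) G" "relboundaries q (K' \<union> L) L G" id
    by (rule homology_quotient_map[OF pairs]) auto
  have "(\<lambda>\<xi>. relboundaries q (K' \<union> L) L G <#>\<^bsub>fun_group (relcycles q (K' \<union> L) L G) G\<^esub> (id ` \<xi>)) \<in>
    iso (simplicial_homology q K' (K' \<inter> L) G) (simplicial_homology q (K' \<union> L) L G)"
    unfolding simplicial_homology_def
  proof (rule induced_iso)
    fix c assume "c \<in> carrier (fun_group (relcycles q (K' \<union> L) L G) G)"
    then have c: "c \<in> chains q (K' \<union> L) G" "boundary G c \<in> chains (q - 1) L G"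
      by (auto simp: relcycles_def)
    obtain c' l where c': "c' \<in> chains q K' G" and l: "l \<in> chains q L G" and eq: "c = (\<lambda>s. c' s \<otimes> l s)"
      using chains_split[OF c(1)] by blast
    \<comment> \<open>Solving for \<open>c'\<close> shows that its boundary lies in
      \<open>L\<close>, since those of \<open>c\<close> and \<open>l\<close> do.\<close>
    have "c' = (\<lambda>s. c s \<otimes> inv l s)"
      using chains_closed[OF c'] chains_closed[OF l] by (simp add: eq m_assoc)
    moreover have "l \<in> chains q (K' \<union> L) G"
      using l chains_mono[OF is_group, of L "K' \<union> L" q] by auto
    ultimately have "boundary G c' = (\<lambda>s. boundary G c s \<otimes> inv boundary G l s)"
      using boundary_mult[OF c(1) chains_inv] by (simp add: boundary_inv)
    then have "boundary G c' \<in> chains (q - 1) L G"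
      using chains_mult[OF c(2) chains_inv[OF boundary_chains_pred[OF L l]]] by simp
    then have "c' \<in> relcycles q K' (K' \<inter> L) G"
      using c' boundary_chains_pred[OF K' c'] by (simp add: relcycles_def chains_Int)
    moreover have "l \<in> relboundaries q (K' \<union> L) L G"
      by (rule relboundariesI[OF chains_one l]) (simp add: boundary_one chains_closed[OF l])
    moreover have "c = (\<lambda>s. l s \<otimes> c' s)"
      using chains_closed[OF c'] chains_closed[OF l] by (simp add: eq m_comm)
    ultimately show "\<exists>z\<in>carrier (fun_group (relcycles q K' (K' \<inter> L) G) G).
        \<exists>b\<in>relboundaries q (K' \<union> L) L G. c = b \<otimes>\<^bsub>fun_group (relcycles q (K' \<union> L) L G) G\<^esub> id z"
      by auto
  next
    fix z assume "z \<in> carrier (fun_group (relcycles q K' (K' \<inter> L) G) G)"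
      and "id z \<in> relboundaries q (K' \<union> L) L G"
    then obtain d e where z: "z \<in> chains q K' G" and d: "d \<in> chains (Suc q) (K' \<union> L) G"
      and e: "e \<in> chains q L G" and eq: "z = (\<lambda>s. boundary G d s \<otimes> e s)"
      by (auto simp: relcycles_def elim: relboundariesE)
    obtain d' l where d': "d' \<in> chains (Suc q) K' G" and l: "l \<in> chains (Suc q) L G"
      and d_eq: "d = (\<lambda>s. d' s \<otimes> l s)"
      using chains_split[OF d] by blast
    have dK: "d' \<in> chains (Suc q) (K' \<union> L) G" "l \<in> chains (Suc q) (K' \<union> L) G"
      using d' l chains_mono[OF is_group, of _ "K' \<union> L" "Suc q"] by auto
    define e' where "e' = (\<lambda>s. boundary G l s \<otimes> e s)"
    have z_eq: "z s = boundary G d' s \<otimes> e' s" for s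
      using boundary_closed[OF d'] boundary_closed[OF l] chains_closed[OF e]
      by (simp add: eq d_eq boundary_mult[OF dK] e'_def m_assoc)
    have e'L: "e' \<in> chains q L G"
      unfolding e'_def by (intro chains_mult boundary_chains L l e)
    \<comment> \<open>The error term is built from chains of \<open>L\<close>; this second
      expression shows that it also lies in \<open>K'\<close>.\<close>
    have "e' = (\<lambda>s. inv boundary G d' s \<otimes> z s)"
      using boundary_closed[OF d'] chains_closed[OF e'L] by (simp add: z_eq flip: m_assoc)
    then have "e' \<in> chains q K' G"
      using chains_mult[OF chains_inv[OF boundary_chains[OF K' d']] z] by simp
    with e'L have "e' \<in> chains q (K' \<inter> L) G" by (simp add: chains_Int)
    then show "z \<in> relboundaries q K' (K' \<inter> L) G"
      by (rule relboundariesI[OF d' _ z_eq])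
  qed
  then show ?thesis
    by (simp add: homology_inclusion_def[abs_def])
qed

lemma homology_system:
  assumes pairs: "\<And>i. i \<in> J \<Longrightarrow> simplicial_pair (K i) (L i)"
    and mono: "\<And>i j. \<lbrakk>i \<in> J; j \<in> J; Q i j\<rbrakk> \<Longrightarrow> K i \<subseteq> K j \<and> L i \<subseteq> L j"
    and trans: "\<And>i j k. \<lbrakk>i \<in> J; j \<in> J; k \<in> J; Q i j; Q j k\<rbrakk> \<Longrightarrow> Q i k"
  shows "functorial_system J Q (\<lambda>i. simplicial_homology q (K i) (L i) G)
           (\<lambda>i j. homology_inclusion q (K j) (L j) G)"
proof (intro functorial_system.intro directed_system.intro functorial_system_axioms.intro)
  fix i j k \<xi> assume "i \<in> J" "j \<in> J" "k \<in> J" "Q i j" "Q j k"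
    "\<xi> \<in> carrier (simplicial_homology q (K i) (L i) G)"
  then show "homology_inclusion q (K k) (L k) G (homology_inclusion q (K j) (L j) G \<xi>)
      = homology_inclusion q (K k) (L k) G \<xi>"
    using mono[of i j] mono[of j k]
    by (intro homology_inclusion_comp[of "K i" "L i"]) (auto intro: pairs)
qed (auto intro!: pairs comm_group_simplicial_homology homology_inclusion_hom dest: mono intro: trans)

end

section \<open>Cohomology of pairs\<close>

context comm_group begin

lemma pointwise_subgroup_relcochains: "pointwise_subgroup G (relcochains q K L G)"
  using pointwise_subgroup_cochains[of q K]
  by (auto simp: pointwise_subgroup_def relcochains_def)

lemma relcochains_cochains: "f \<in> relcochains q K L G \<Longrightarrow> f \<in> cochains q K G"
  by (simp add: relcochains_def)

lemma coboundary_relcochains: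
  assumes "face_closed K" "face_closed L" and f: "f \<in> relcochains q K L G"
  shows "coboundary q K G f \<in> relcochains (Suc q) K L G"
proof -
  have "coboundary q K G f s = \<one>" if "s \<in> ordered_simplices (Suc q) L" for s
  proof -
    have "f (face i s) = \<one>" if "i \<le> Suc q" for i
      using f face_ordered_simplices[OF assms(2) \<open>s \<in> _\<close> that] by (simp add: relcochains_def)
    then show ?thesis
      by (auto simp: coboundary_def intro!: finprod_one_eqI)
  qed
  then show ?thesis
    using coboundary_cochains[OF assms(1)] f by (simp add: relcochains_def)
qed

lemma pointwise_subgroup_relcocycles: "pointwise_subgroup G (relcocycles q K L G)"
  using pointwise_subgroup_relcochains[of q K L]
  by (auto simp: pointwise_subgroup_def relcocycles_def coboundary_one
      coboundary_mult[OF relcochains_cochains relcochains_cochains] coboundary_inv[OF relcochains_cochains])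

lemma pointwise_subgroup_relcoboundaries: "pointwise_subgroup G (relcoboundaries q K L G)"
proof (cases q)
  case 0
  then show ?thesis by (simp add: pointwise_subgroup_def relcoboundaries_def)
next
  case (Suc r)
  note rel = pointwise_subgroup_relcochains[of r K L, unfolded pointwise_subgroup_def]
  have "pointwise_subgroup G (coboundary r K G ` relcochains r K L G)"
    unfolding pointwise_subgroup_def
  proof (intro conjI ballI allI)
    fix f assume "f \<in> coboundary r K G ` relcochains r K L G"
    then obtain f' where f': "f = coboundary r K G f'" "f' \<in> relcochains r K L G" by blast
    show "f s \<in> carrier G" for s
      using f' by (simp add: coboundary_closed relcochains_cochains)
    have "(\<lambda>s. inv f s) = coboundary r K G (\<lambda>s. inv f' s)"
      using f' by (simp add: coboundary_inv relcochains_cochains)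
    then show "(\<lambda>s. inv f s) \<in> coboundary r K G ` relcochains r K L G"
      using rel f' by blast
    fix g assume "g \<in> coboundary r K G ` relcochains r K L G"
    then obtain g' where g': "g = coboundary r K G g'" "g' \<in> relcochains r K L G" by blast
    have "(\<lambda>s. f s \<otimes> g s) = coboundary r K G (\<lambda>s. f' s \<otimes> g' s)"
      using f' g' by (simp add: coboundary_mult relcochains_cochains)
    then show "(\<lambda>s. f s \<otimes> g s) \<in> coboundary r K G ` relcochains r K L G"
      using rel f' g' by blast
  next
    show "(\<lambda>s. \<one>) \<in> coboundary r K G ` relcochains r K L G"
      using rel coboundary_one[of r K] by (metis imageI)
  qed
  then show ?thesis by (simp add: relcoboundaries_def Suc)
qed

lemma relcoboundaries_subset:
  assumes "simplicial_pair K L"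
  shows "relcoboundaries q K L G \<subseteq> relcocycles q K L G"
proof (cases q)
  case 0
  then show ?thesis
    using pointwise_subgroup_relcocycles[of q K L] by (simp add: pointwise_subgroup_def relcoboundaries_def)
next
  case (Suc r)
  then show ?thesis
    using assms coboundary_relcochains[of K L _ r] coboundary_coboundary[of K _ r]
    by (auto simp: relcoboundaries_def relcocycles_def simplicial_pair_def relcochains_cochains)
qed

lemma subgroup_relcoboundaries:
  "simplicial_pair K L \<Longrightarrow> subgroup (relcoboundaries q K L G) (fun_group (relcocycles q K L G) G)"
  by (intro subgroup_fun_group pointwise_subgroup_relcocycles pointwise_subgroup_relcoboundaries relcoboundaries_subset)

lemma comm_group_simplicial_cohomology:
  "simplicial_pair K L \<Longrightarrow> comm_group (simplicial_cohomology q K L G)"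
  unfolding simplicial_cohomology_def
  by (intro comm_group.abelian_FactGroup comm_group_fun_group pointwise_subgroup_relcocycles subgroup_relcoboundaries)

lemma restrict_cochain_relcochains:
  assumes "K' \<subseteq> K" "L' \<subseteq> L" and f: "f \<in> relcochains q K L G"
  shows "restrict_cochain q K' G f \<in> relcochains q K' L' G"
proof -
  have c: "f \<in> cochains q K G" using f by (rule relcochains_cochains)
  have "restrict_cochain q K' G f = (\<lambda>s. if set s \<in> K' then f s else \<one>)"
    using c by (auto simp: restrict_cochain_def ordered_simplices_def cochains_def fun_eq_iff)
  moreover have "{t \<in> K. t \<in> K'} = K'" using assms(1) by auto
  ultimately have "restrict_cochain q K' G f \<in> cochains q K' G"
    using cochains_restrict[OF is_group c, of "\<lambda>t. t \<in> K'"] by simp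
  then show ?thesis
    using f ordered_simplices_mono[OF assms(2), of q] by (auto simp: relcochains_def restrict_cochain_def)
qed

text \<open>Faces of a simplex of \<open>K'\<close> again belong to \<open>K'\<close>, so
  restricting first loses nothing.\<close>

lemma coboundary_restrict_cochain:
  assumes "face_closed K'" "K' \<subseteq> K" and f: "f \<in> cochains q K G"
  shows "coboundary q K' G (restrict_cochain q K' G f) = restrict_cochain (Suc q) K' G (coboundary q K G f)"
proof
  fix s
  show "coboundary q K' G (restrict_cochain q K' G f) s = restrict_cochain (Suc q) K' G (coboundary q K G f) s"
  proof (cases "s \<in> ordered_simplices (Suc q) K'")
    case True
    then have sK: "s \<in> ordered_simplices (Suc q) K"
      using ordered_simplices_mono[OF assms(2)] by blast
    have "finprod G (\<lambda>i. restrict_cochain q K' G f (face i s) [^] ((-1) ^ i :: int)) {..Suc q} =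
        finprod G (\<lambda>i. f (face i s) [^] ((-1) ^ i :: int)) {..Suc q}"
      using face_ordered_simplices[OF assms(1) True]
      by (intro finprod_cong') (auto simp: restrict_cochain_def cochains_closed[OF f])
    then show ?thesis
      using True sK by (simp add: coboundary_def restrict_cochain_def)
  qed (simp add: coboundary_def restrict_cochain_def)
qed

lemma cohomology_quotient_map:
  assumes pairs: "simplicial_pair K L" "simplicial_pair K' L'" and sub: "K' \<subseteq> K" "L' \<subseteq> L"
  shows "quotient_map (fun_group (relcocycles q K L G) G) (relcoboundaries q K L G)
           (fun_group (relcocycles q K' L' G) G) (relcoboundaries q K' L' G) (restrict_cochain q K' G)"
proof -
  have K': "face_closed K'" using pairs by (simp add: simplicial_pair_def)
  have cocycles: "restrict_cochain q K' G f \<in> relcocycles q K' L' G" if "f \<in> relcocycles q K L G" for f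
    using that restrict_cochain_relcochains[OF sub, of f q]
      coboundary_restrict_cochain[OF K' sub(1), of f q]
    by (auto simp: relcocycles_def relcochains_cochains restrict_cochain_def fun_eq_iff)
  have "restrict_cochain q K' G ` relcoboundaries q K L G \<subseteq> relcoboundaries q K' L' G"
  proof (cases q)
    case 0
    then show ?thesis by (auto simp: relcoboundaries_def restrict_cochain_def)
  next
    case (Suc r)
    show ?thesis
    proof
      fix f assume "f \<in> restrict_cochain q K' G ` relcoboundaries q K L G"
      then obtain g where g: "g \<in> relcochains r K L G"
        and f: "f = restrict_cochain (Suc r) K' G (coboundary r K G g)"
        by (auto simp: relcoboundaries_def Suc)
      have "f = coboundary r K' G (restrict_cochain r K' G g)"
        using coboundary_restrict_cochain[OF K' sub(1) relcochains_cochains[OF g]] f by simp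
      then show "f \<in> relcoboundaries q K' L' G"
        using restrict_cochain_relcochains[OF sub g] by (auto simp: relcoboundaries_def Suc)
    qed
  qed
  moreover have "restrict_cochain q K' G \<in>
      hom (fun_group (relcocycles q K L G) G) (fun_group (relcocycles q K' L' G) G)"
    using cocycles by (auto simp: hom_def restrict_cochain_def fun_eq_iff)
  ultimately show ?thesis
    unfolding quotient_map_def quotient_map_axioms_def
    by (auto intro!: comm_group_fun_group pointwise_subgroup_relcocycles subgroup_relcoboundaries pairs)
qed

lemma cohomology_restriction_coset:
  assumes "simplicial_pair K L" "simplicial_pair K' L'" "K' \<subseteq> K" "L' \<subseteq> L" "f \<in> relcocycles q K L G"
  shows "cohomology_restriction q K' L' G (relcoboundaries q K L G #>\<^bsub>fun_group (relcocycles q K L G) G\<^esub> f)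
       = relcoboundaries q K' L' G #>\<^bsub>fun_group (relcocycles q K' L' G) G\<^esub> restrict_cochain q K' G f"
  using quotient_map.induced_coset[OF cohomology_quotient_map[OF assms(1-4), of q], of f] assms(5)
  by (simp add: cohomology_restriction_def)

lemma cohomology_restriction_hom:
  assumes "simplicial_pair K L" "simplicial_pair K' L'" "K' \<subseteq> K" "L' \<subseteq> L"
  shows "cohomology_restriction q K' L' G \<in> hom (simplicial_cohomology q K L G) (simplicial_cohomology q K' L' G)"
  using quotient_map.induced_hom[OF cohomology_quotient_map[OF assms, of q]]
  by (simp add: cohomology_restriction_def[abs_def] simplicial_cohomology_def)

lemma cohomology_restriction_comp:
  assumes "simplicial_pair K L" "simplicial_pair K' L'" "simplicial_pair K'' L''"
    and sub: "K' \<subseteq> K" "L' \<subseteq> L" "K'' \<subseteq> K'" "L'' \<subseteq> L'"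
    and "\<xi> \<in> carrier (simplicial_cohomology q K L G)"
  shows "cohomology_restriction q K'' L'' G (cohomology_restriction q K' L' G \<xi>)
       = cohomology_restriction q K'' L'' G \<xi>"
proof -
  obtain f where f: "f \<in> relcocycles q K L G"
    "\<xi> = relcoboundaries q K L G #>\<^bsub>fun_group (relcocycles q K L G) G\<^esub> f"
    using assms by (auto simp: simplicial_cohomology_def carrier_FactGroup)
  interpret quotient_map "fun_group (relcocycles q K L G) G" "relcoboundaries q K L G"
    "fun_group (relcocycles q K' L' G) G" "relcoboundaries q K' L' G" "restrict_cochain q K' G"
    by (rule cohomology_quotient_map) fact+
  have f': "restrict_cochain q K' G f \<in> relcocycles q K' L' G"
    using hom_in_carrier[OF h, of f] f by simp
  have "restrict_cochain q K'' G (restrict_cochain q K' G f) = restrict_cochain q K'' G f"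
    using ordered_simplices_mono[OF sub(3), of q] by (auto simp: restrict_cochain_def fun_eq_iff)
  moreover have "K'' \<subseteq> K" "L'' \<subseteq> L" using sub by auto
  ultimately show ?thesis
    using assms f f' by (simp add: cohomology_restriction_coset)
qed

lemma cohomology_system:
  assumes pairs: "\<And>i. i \<in> J \<Longrightarrow> simplicial_pair (K i) (L i)"
    and mono: "\<And>i j. \<lbrakk>i \<in> J; j \<in> J; Q i j\<rbrakk> \<Longrightarrow> K j \<subseteq> K i \<and> L j \<subseteq> L i"
    and trans: "\<And>i j k. \<lbrakk>i \<in> J; j \<in> J; k \<in> J; Q i j; Q j k\<rbrakk> \<Longrightarrow> Q i k"
  shows "functorial_system J Q (\<lambda>i. simplicial_cohomology q (K i) (L i) G)
           (\<lambda>i j. cohomology_restriction q (K j) (L j) G)"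
proof (intro functorial_system.intro directed_system.intro functorial_system_axioms.intro)
  fix i j k \<xi> assume "i \<in> J" "j \<in> J" "k \<in> J" "Q i j" "Q j k"
    "\<xi> \<in> carrier (simplicial_cohomology q (K i) (L i) G)"
  then show "cohomology_restriction q (K k) (L k) G (cohomology_restriction q (K j) (L j) G \<xi>)
      = cohomology_restriction q (K k) (L k) G \<xi>"
    using mono[of i j] mono[of j k]
    by (intro cohomology_restriction_comp[of "K i" "L i"]) (auto intro: pairs)
qed (auto intro!: pairs comm_group_simplicial_cohomology cohomology_restriction_hom dest: mono intro: trans)

text \<open>A relative cochain of \<open>(K' \<union> L, L)\<close> is already a relative cochain of \<open>(K', K' \<inter> L)\<close>, since
  cochains are extended by the neutral element; excision in cohomology is thus an equality.\<close>

lemma relcochains_excision: "relcochains q (K' \<union> L) L G = relcochains q K' (K' \<inter> L) G"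
proof (intro equalityI subsetI)
  fix f assume f: "f \<in> relcochains q (K' \<union> L) L G"
  have "f s = \<one>" if "s \<notin> ordered_simplices q K'" for s
    using f that by (auto simp: relcochains_def cochains_def ordered_simplices_def)
  then show "f \<in> relcochains q K' (K' \<inter> L) G"
    using f by (auto simp: relcochains_def cochains_def ordered_simplices_def)
next
  fix f assume f: "f \<in> relcochains q K' (K' \<inter> L) G"
  have "f \<in> cochains q (K' \<union> L) G"
    using f cochains_mono[OF is_group, of K' "K' \<union> L" q] by (auto simp: relcochains_def)
  moreover have "f s = \<one>" if "s \<in> ordered_simplices q L" for s
    using f that by (cases "set s \<in> K'") (auto simp: relcochains_def cochains_def ordered_simplices_def)
  ultimately show "f \<in> relcochains q (K' \<union> L) L G"
    by (simp add: relcochains_def)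
qed

text \<open>The two sides could differ only at simplices of \<open>L\<close> outside
  \<open>K'\<close>; the faces of these lie in \<open>L\<close>, where \<open>f\<close> is
  neutral.\<close>

lemma coboundary_excision:
  assumes "face_closed L" and f: "f \<in> relcochains q (K' \<union> L) L G"
  shows "coboundary q (K' \<union> L) G f = coboundary q K' G f"
proof
  fix s
  have "finprod G (\<lambda>i. f (face i s) [^] ((-1) ^ i :: int)) {..Suc q} = \<one>"
    if s: "s \<in> ordered_simplices (Suc q) L"
  proof (rule finprod_one_eqI)
    fix i assume "i \<in> {..Suc q}"
    then have "f (face i s) = \<one>"
      using f face_ordered_simplices[OF assms(1) s, of i] by (simp add: relcochains_def)
    then show "f (face i s) [^] ((-1) ^ i :: int) = \<one>" by simp
  qed
  then show "coboundary q (K' \<union> L) G f s = coboundary q K' G f s"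
    by (auto simp: coboundary_def ordered_simplices_def)
qed

lemma relcocycles_excision:
  "face_closed L \<Longrightarrow> relcocycles q (K' \<union> L) L G = relcocycles q K' (K' \<inter> L) G"
  using coboundary_excision[of L _ q K'] by (auto simp: relcocycles_def simp flip: relcochains_excision)

lemma relcoboundaries_excision:
  "face_closed L \<Longrightarrow> relcoboundaries q (K' \<union> L) L G = relcoboundaries q K' (K' \<inter> L) G"
  using coboundary_excision[of L] 
  by (auto simp: relcoboundaries_def simp flip: relcochains_excision split: nat.splits intro!: image_cong)

lemma cohomology_excision:
  "face_closed L \<Longrightarrow> simplicial_cohomology q (K' \<union> L) L G = simplicial_cohomology q K' (K' \<inter> L) G"
  by (simp add: simplicial_cohomology_def relcocycles_excision relcoboundaries_excision)

text \<open>Representatives of \<xi> are neutral on \<open>L1\<close> and hence on \<open>L\<close>,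
  so restricting them to the union or to \<open>K'\<close> gives the same function. The target
  cosets agree because excision is an equality for cocycles and coboundaries.\<close>

lemma cohomology_restriction_excision:
  assumes pair: "simplicial_pair K1 L1" and L: "face_closed L" and sub: "K' \<union> L \<subseteq> K1" "L \<subseteq> L1"
    and \<xi>: "\<xi> \<in> carrier (simplicial_cohomology q K1 L1 G)"
  shows "cohomology_restriction q (K' \<union> L) L G \<xi> = cohomology_restriction q K' (K' \<inter> L) G \<xi>"
proof -
  interpret Z: comm_group "fun_group (relcocycles q K1 L1 G) G"
    by (intro comm_group_fun_group pointwise_subgroup_relcocycles)
  have "\<xi> \<subseteq> relcocycles q K1 L1 G"
    using \<xi> Z.r_coset_subset_G[OF subgroup.subset[OF subgroup_relcoboundaries[OF pair, of q]]]
    by (auto simp: simplicial_cohomology_def carrier_FactGroup)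
  moreover have "restrict_cochain q (K' \<union> L) G f = restrict_cochain q K' G f"
    if "f \<in> relcocycles q K1 L1 G" for f
  proof -
    have "f s = \<one>" if "s \<in> ordered_simplices q L" for s
      using \<open>f \<in> _\<close> ordered_simplices_mono[OF sub(2), of q] that
      by (auto simp: relcocycles_def relcochains_def)
    then show ?thesis
      by (auto simp: restrict_cochain_def ordered_simplices_def fun_eq_iff)
  qed
  ultimately have "restrict_cochain q (K' \<union> L) G ` \<xi> = restrict_cochain q K' G ` \<xi>"
    by (intro image_cong) auto
  then show ?thesis
    using L by (simp add: cohomology_restriction_def relcocycles_excision relcoboundaries_excision)
qed

end

section \<open>Vietoris-Rips complexes\<close>

lemma vr_complex_iff:
  "s \<in> vr_complex X U \<longleftrightarrow> (\<exists>xs. s = set xs \<and> xs \<noteq> [] \<and> set xs \<subseteq> X \<and> distinct xs \<and> sorted_wrt (\<lambda>x y. (x, y) \<in> U) xs)"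
  by (auto simp: vr_complex_def sorted_wrt_iff_nth_less)

text \<open>These are full subcomplexes, so their unions and intersections can be decided on vertex
  sets.\<close>

lemma vr_complex_subset_iff: "A \<subseteq> X \<Longrightarrow> s \<in> vr_complex A U \<longleftrightarrow> s \<in> vr_complex X U \<and> s \<subseteq> A"
  unfolding vr_complex_iff by blast

lemma face_closed_vr_complex: "face_closed (vr_complex X U)"
  unfolding face_closed_def
proof (intro ballI allI impI)
  fix s t assume "s \<in> vr_complex X U" and t: "t \<noteq> {} \<and> t \<subseteq> s"
  then obtain xs where xs: "s = set xs" "set xs \<subseteq> X" "distinct xs" "sorted_wrt (\<lambda>x y. (x, y) \<in> U) xs"
    by (auto simp: vr_complex_iff)
  \<comment> \<open>A face is ordered by deleting the other vertices from an admissible ordering of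
    the simplex.\<close>
  let ?ys = "filter (\<lambda>x. x \<in> t) xs"
  have "set ?ys = t" using xs t by auto
  moreover have "?ys \<noteq> []" using \<open>set ?ys = t\<close> t by (metis list.set(1))
  moreover have "sorted_wrt (\<lambda>x y. (x, y) \<in> U) ?ys" using xs(4) by (rule sorted_wrt_filter)
  ultimately show "t \<in> vr_complex X U"
    unfolding vr_complex_iff using xs t by (intro exI[of _ ?ys]) auto
qed

lemma vr_complex_mono: "U \<subseteq> U' \<Longrightarrow> vr_complex X U \<subseteq> vr_complex X U'"
  unfolding vr_complex_def by blast

text \<open>The complex on \<open>A\<close> only sees pairs inside \<open>A\<close>. This removes
  the restriction from the definition of the groups of a pair, and later identifies the complexes of
  \<open>U\<close> with those of its trace on \<open>X - B\<close>.\<close>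

lemma vr_complex_restrict_rel:
  assumes "A \<subseteq> Y"
  shows "vr_complex A (restrict_rel Y U) = vr_complex A U"
proof -
  have "(xs ! i, xs ! j) \<in> restrict_rel Y U \<longleftrightarrow> (xs ! i, xs ! j) \<in> U"
    if "set xs \<subseteq> A" "i < j" "j < length xs" for xs i j
  proof -
    have "xs ! i \<in> Y" "xs ! j \<in> Y"
      using that assms nth_mem[of i xs] nth_mem[of j xs] by (meson less_trans subsetD)+
    then show ?thesis by (simp add: restrict_rel_def)
  qed
  then show ?thesis
    unfolding vr_complex_def by (intro Collect_cong ex_cong1) auto
qed

text \<open>The order of the two vertices in an admissible ordering is unknown and \<open>U\<close>
  need not be symmetric, so either direction may occur; this is why
  \<open>excisive_entourage\<close> has to control \<open>U\<inverse>\<close> too.\<close>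

lemma vr_complex_adjacent:
  assumes "s \<in> vr_complex X U" "x \<in> s" "y \<in> s" "x \<noteq> y"
  shows "(x, y) \<in> U \<or> (y, x) \<in> U"
proof -
  obtain xs where xs: "s = set xs" "\<And>i j. \<lbrakk>i < j; j < length xs\<rbrakk> \<Longrightarrow> (xs ! i, xs ! j) \<in> U"
    using assms(1) by (auto simp: vr_complex_def)
  obtain i j where "i < length xs" "x = xs ! i" "j < length xs" "y = xs ! j"
    using assms xs(1) by (metis in_set_conv_nth)
  then show ?thesis
    using xs(2)[of i j] xs(2)[of j i] assms(4) by (metis nat_neq_iff)
qed

lemma vr_complex_excision:
  assumes "B \<subseteq> A" "A \<subseteq> X" "U `` B \<subseteq> A" "U\<inverse> `` B \<subseteq> A"
  shows "vr_complex X U = vr_complex (X - B) U \<union> vr_complex A U"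
proof (intro equalityI subsetI)
  fix s assume s: "s \<in> vr_complex X U"
  then have "s \<subseteq> X" by (auto simp: vr_complex_iff)
  \<comment> \<open>The vertex \<open>b\<close> itself is covered by \<open>B \<subseteq> A\<close>,
    every other vertex by adjacency to \<open>b\<close>.\<close>
  have "s \<subseteq> A" if b: "b \<in> B" "b \<in> s" for b
    using vr_complex_adjacent[OF s b(2)] assms b(1) by blast
  then have "s \<subseteq> X - B \<or> s \<subseteq> A"
    using \<open>s \<subseteq> X\<close> by blast
  then show "s \<in> vr_complex (X - B) U \<union> vr_complex A U"
    using s vr_complex_subset_iff[of "X - B" X s U] vr_complex_subset_iff[of A X s U] assms(2) by auto
next
  fix s assume "s \<in> vr_complex (X - B) U \<union> vr_complex A U"
  then show "s \<in> vr_complex X U"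
    using vr_complex_subset_iff[of "X - B" X s U] vr_complex_subset_iff[of A X s U] assms(2) by auto
qed

lemma vr_complex_Diff:
  assumes "A \<subseteq> X"
  shows "vr_complex (A - B) U = vr_complex (X - B) U \<inter> vr_complex A U"
proof (rule Set.set_eqI)
  fix s
  have "A - B \<subseteq> X" "s \<subseteq> A - B \<longleftrightarrow> s \<subseteq> X - B \<and> s \<subseteq> A" using assms by auto
  then show "s \<in> vr_complex (A - B) U \<longleftrightarrow> s \<in> vr_complex (X - B) U \<inter> vr_complex A U"
    using assms by (auto simp: vr_complex_subset_iff[of "X - B" X] vr_complex_subset_iff[of "A - B" X]
        vr_complex_subset_iff[of A X])
qed

lemma simplicial_pair_vr_complex: "A \<subseteq> X \<Longrightarrow> simplicial_pair (vr_complex X U) (vr_complex A U)"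
  by (auto simp: simplicial_pair_def face_closed_vr_complex vr_complex_subset_iff[of A X])

lemma vr_homology_eq:
  "vr_homology q X A F G = inverse_limit F (\<lambda>U U'. U \<subseteq> U')
     (\<lambda>U. simplicial_homology q (vr_complex X U) (vr_complex A U) G)
     (\<lambda>U U'. homology_inclusion q (vr_complex X U') (vr_complex A U') G)"
  by (simp add: vr_homology_def vr_homology_at_def[abs_def] vr_complex_restrict_rel)

lemma vr_cohomology_eq:
  "vr_cohomology q X A F G = direct_limit F (\<lambda>U' U. U \<subseteq> U')
     (\<lambda>U. simplicial_cohomology q (vr_complex X U) (vr_complex A U) G)
     (\<lambda>U' U. cohomology_restriction q (vr_complex X U) (vr_complex A U) G)"
  by (simp add: vr_cohomology_def vr_cohomology_at_def[abs_def] vr_complex_restrict_rel)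

section \<open>Systems of Vietoris-Rips groups and the empty space\<close>

context comm_group begin

lemma vr_homology_system:
  assumes "A \<subseteq> X"
  shows "functorial_system F (\<lambda>U U'. U \<subseteq> U')
     (\<lambda>U. simplicial_homology q (vr_complex X U) (vr_complex A U) G)
     (\<lambda>U U'. homology_inclusion q (vr_complex X U') (vr_complex A U') G)"
  by (rule homology_system) (auto simp: assms simplicial_pair_vr_complex vr_complex_mono)

lemma vr_cohomology_system:
  assumes "A \<subseteq> X"
  shows "functorial_system F (\<lambda>U' U. U \<subseteq> U')
     (\<lambda>U. simplicial_cohomology q (vr_complex X U) (vr_complex A U) G)
     (\<lambda>U' U. cohomology_restriction q (vr_complex X U) (vr_complex A U) G)"
  by (rule cohomology_system) (auto simp: assms simplicial_pair_vr_complex vr_complex_mono)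

lemma trivial_simplicial_homology_empty: "trivial_group (simplicial_homology q {} {} G)"
proof -
  have "relcycles q {} {} G \<subseteq> {\<lambda>s. \<one>}"
    using cochains_empty[OF is_group, of q] by (auto simp: relcycles_def chains_def)
  then have "\<exists>a. carrier (simplicial_homology q {} {} G) \<subseteq> {a}"
    by (auto simp: simplicial_homology_def carrier_FactGroup)
  moreover have "group (simplicial_homology q {} {} G)"
    by (intro comm_group.axioms(2) comm_group_simplicial_homology) (simp add: simplicial_pair_def face_closed_def)
  ultimately show ?thesis
    using group.trivial_group_alt by blast
qed

lemma trivial_simplicial_cohomology_empty: "trivial_group (simplicial_cohomology q {} {} G)"
proof -
  have "relcocycles q {} {} G \<subseteq> {\<lambda>s. \<one>}"
    using cochains_empty[OF is_group, of q] by (auto simp: relcocycles_def relcochains_def)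
  then have "\<exists>a. carrier (simplicial_cohomology q {} {} G) \<subseteq> {a}"
    by (auto simp: simplicial_cohomology_def carrier_FactGroup)
  moreover have "group (simplicial_cohomology q {} {} G)"
    by (intro comm_group.axioms(2) comm_group_simplicial_cohomology) (simp add: simplicial_pair_def face_closed_def)
  ultimately show ?thesis
    using group.trivial_group_alt by blast
qed

text \<open>Stated for every \<open>F\<close>, because for \<open>Y = {}\<close> the two index sets
  compared in \<open>trace_structure_iso\<close> are different.\<close>

lemma vr_empty_trivial:
  "trivial_group (vr_homology q {} {} F G)" "trivial_group (vr_cohomology q {} {} F G)"
proof -
  have empty: "vr_complex {} U = {}" for U :: "('v \<times> 'v) set"
    by (auto simp: vr_complex_def)
  show "trivial_group (vr_homology q {} {} F G)"
    unfolding vr_homology_eq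
    by (rule functorial_system.trivial_inverse_limit[OF vr_homology_system])
      (simp_all add: empty trivial_simplicial_homology_empty)
  show "trivial_group (vr_cohomology q {} {} F G)"
    unfolding vr_cohomology_eq
    by (rule directed_system.trivial_direct_limit[OF functorial_system.axioms(1)[OF vr_cohomology_system]])
      (simp_all add: empty trivial_simplicial_cohomology_empty)
qed

text \<open>For \<open>Y = {}\<close> the trace structure omits the empty relation, so that its index set is empty.\<close>

lemma trace_structure_iso:
  assumes F: "semi_uniform_space X F" and "Y \<subseteq> X" "A \<subseteq> Y"
  shows "vr_homology q Y A (trace_structure Y F) G \<cong> vr_homology q Y A (restrict_rel Y ` F) G"
    and "vr_cohomology q Y A (trace_structure Y F) G \<cong> vr_cohomology q Y A (restrict_rel Y ` F) G"
proof -
  have "vr_homology q Y A (trace_structure Y F) G \<cong> vr_homology q Y A (restrict_rel Y ` F) G \<and>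
    vr_cohomology q Y A (trace_structure Y F) G \<cong> vr_cohomology q Y A (restrict_rel Y ` F) G"
  proof (cases "Y = {}")
    case True
    then show ?thesis
      using assms(3) by (simp add: trivial_groups_isomorphic vr_empty_trivial)
  next
    case False
    have "restrict_rel Y U \<noteq> {}" if "U \<in> F" for U
    proof -
      obtain y where "y \<in> Y" using False by blast
      moreover have "Id_on X \<subseteq> U" using F that by (simp add: semi_uniform_space_def)
      ultimately have "(y, y) \<in> restrict_rel Y U"
        using assms(2) by (auto simp: restrict_rel_def)
      then show ?thesis by blast
    qed
    then have "trace_structure Y F = restrict_rel Y ` F"
      by (auto simp: trace_structure_def)
    then show ?thesis by simp
  qed
  then show "vr_homology q Y A (trace_structure Y F) G \<cong> vr_homology q Y A (restrict_rel Y ` F) G"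
    and "vr_cohomology q Y A (trace_structure Y F) G \<cong> vr_cohomology q Y A (restrict_rel Y ` F) G" by auto
qed

end

text \<open>The hypothesis bounds only the pairs that start in \<open>B\<close>. Below
  \<open>W \<inter> W\<inverse>\<close> the converse of \<open>U\<close> is contained in
  \<open>W\<close>, so the pairs that end in \<open>B\<close> are bounded as well.\<close>

lemma excisive_entourage:
  assumes "semi_uniform_space X F" "W \<in> F" "\<And>U. \<lbrakk>U \<in> F; U \<subseteq> W\<rbrakk> \<Longrightarrow> U `` B \<subseteq> A"
  obtains W' where "W' \<in> F" "\<And>U. \<lbrakk>U \<in> F; U \<subseteq> W'\<rbrakk> \<Longrightarrow> U `` B \<subseteq> A \<and> U\<inverse> `` B \<subseteq> A"
proof
  have "W \<subseteq> X \<times> X"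
    using assms(1,2) by (auto simp: semi_uniform_space_def)
  then have "W\<inverse> \<subseteq> X \<times> X" by auto
  moreover have "\<exists>V\<in>F. V \<subseteq> W\<inverse>"
    using assms(1,2) by (simp add: semi_uniform_space_def)
  then obtain V where "V \<in> F" "V \<subseteq> W\<inverse>" by blast
  \<comment> \<open>The axiom only provides a member of \<open>F\<close> inside
    \<open>W\<inverse>\<close>; closure under supersets does the rest.\<close>
  ultimately have "W\<inverse> \<in> F"
    using assms(1) unfolding semi_uniform_space_def by meson
  then show "W \<inter> W\<inverse> \<in> F"
    using assms(1,2) by (simp add: semi_uniform_space_def)
  fix U assume U: "U \<in> F" "U \<subseteq> W \<inter> W\<inverse>"
  \<comment> \<open>The hypothesis is then applied to \<open>W\<close> itself, which avoids showing
    that \<open>U\<inverse>\<close> belongs to \<open>F\<close>.\<close>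
  have "U\<inverse> `` B \<subseteq> W `` B" using U by blast
  then show "U `` B \<subseteq> A \<and> U\<inverse> `` B \<subseteq> A"
    using assms(3)[OF U(1)] assms(3)[OF assms(2)] U(2) by blast
qed

theorem theorem4p9:
  fixes X A B :: "'a set"
    and F :: "('a \<times> 'a) set set"
    and G :: "('g, 'm) monoid_scheme"
    and q :: nat
  assumes "semi_uniform_space X F"
    and "B \<subseteq> A" and "A \<subseteq> X"
    and "comm_group G"
    and "\<exists>W\<in>F. \<forall>U\<in>F. U \<subseteq> W \<longrightarrow> U `` B \<subseteq> A"
  shows "vr_cohomology q (X - B) (A - B) (trace_structure (X - B) F) G \<cong> vr_cohomology q X A F G
       \<and> vr_homology q (X - B) (A - B) (trace_structure (X - B) F) G \<cong> vr_homology q X A F G"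
proof -
  interpret comm_group G by fact
  obtain W where W: "W \<in> F" "\<And>U. \<lbrakk>U \<in> F; U \<subseteq> W\<rbrakk> \<Longrightarrow> U `` B \<subseteq> A \<and> U\<inverse> `` B \<subseteq> A"
    using assms(5) excisive_entourage[OF assms(1)] by metis
  have F_Int: "U \<inter> V \<in> F" if "U \<in> F" "V \<in> F" for U V
    using assms(1) that by (simp add: semi_uniform_space_def)
  define I where "I = {U \<in> F. U \<subseteq> W}"
  let ?\<rho> = "restrict_rel (X - B)"
  \<comment> \<open>This image differs from the trace structure only when \<open>X - B\<close> is
    empty; \<open>trace_structure_iso\<close> bridges the gap at the end.\<close>
  let ?F' = "?\<rho> ` F"
  have IF: "U \<in> F" if "U \<in> I" for U using that by (simp add: I_def)
  have dir: "\<exists>k\<in>I. k \<subseteq> i \<and> k \<subseteq> j" if "i \<in> I" "j \<in> I" for i j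
    using that F_Int[of i j] by (intro bexI[of _ "i \<inter> j"]) (auto simp: I_def)
  have cofinal: "\<exists>i\<in>I. i \<subseteq> U" if "U \<in> F" for U
    using that W F_Int[of U W] by (intro bexI[of _ "U \<inter> W"]) (auto simp: I_def)
  have \<rho>_mono: "?\<rho> U \<subseteq> ?\<rho> V" if "U \<subseteq> V" for U V :: "('a \<times> 'a) set"
    using that by (auto simp: restrict_rel_def)
  have cofinal': "\<exists>i\<in>I. ?\<rho> i \<subseteq> V" if "V \<in> ?F'" for V
    using that cofinal \<rho>_mono by (metis imageE)
  have exc: "vr_complex X U = vr_complex (X - B) U \<union> vr_complex A U"
    "vr_complex (A - B) U = vr_complex (X - B) U \<inter> vr_complex A U" if "U \<in> I" for U
  proof -
    have "U `` B \<subseteq> A" "U\<inverse> `` B \<subseteq> A"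
      using that W(2)[of U] by (simp_all add: I_def)
    then show "vr_complex X U = vr_complex (X - B) U \<union> vr_complex A U"
      by (rule vr_complex_excision[OF assms(2,3)])
    show "vr_complex (A - B) U = vr_complex (X - B) U \<inter> vr_complex A U"
      by (rule vr_complex_Diff) fact
  qed
  have sub: "A - B \<subseteq> X - B" using assms(3) by blast
  have res: "vr_complex (X - B) (?\<rho> U) = vr_complex (X - B) U" "vr_complex (A - B) (?\<rho> U) = vr_complex (A - B) U" for U
    by (rule vr_complex_restrict_rel, rule subset_refl, rule vr_complex_restrict_rel, rule sub)

  let ?H = "\<lambda>X A U. simplicial_cohomology q (vr_complex X U) (vr_complex A U) G"
  let ?r = "\<lambda>X A U. cohomology_restriction q (vr_complex X U) (vr_complex A U) G"
  interpret C: functorial_system F "\<lambda>U' U. U \<subseteq> U'" "?H X A" "\<lambda>_. ?r X A"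
    by (rule vr_cohomology_system) fact
  interpret C': functorial_system ?F' "\<lambda>U' U. U \<subseteq> U'" "?H (X - B) (A - B)" "\<lambda>_. ?r (X - B) (A - B)"
    by (rule vr_cohomology_system) fact
  interpret CI: functorial_system I "\<lambda>U' U. U \<subseteq> U'" "?H X A" "\<lambda>_. ?r X A"
    by (rule vr_cohomology_system) fact
  \<comment> \<open>The map of index sets is \<open>?\<rho>\<close> here and the identity in
    \<open>iso\<close>.\<close>
  have iso': "direct_limit I (\<lambda>U' U. U \<subseteq> U') (\<lambda>U. ?H (X - B) (A - B) (?\<rho> U)) (\<lambda>U' U. ?r (X - B) (A - B) (?\<rho> U))
      \<cong> vr_cohomology q (X - B) (A - B) ?F' G"
    unfolding vr_cohomology_eq
    by (rule C'.direct_limit_cofinal) (use dir cofinal' \<rho>_mono IF in auto)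
  have iso: "direct_limit I (\<lambda>U' U. U \<subseteq> U') (?H X A) (\<lambda>_. ?r X A) \<cong> vr_cohomology q X A F G"
    unfolding vr_cohomology_eq
    by (rule C.direct_limit_cofinal[of I _ "\<lambda>U. U"]) (use dir cofinal IF in auto)
  \<comment> \<open>Over \<open>I\<close> the two systems have equal groups and equal restriction
    maps on them, so the limits are the same object.\<close>
  have "direct_limit I (\<lambda>U' U. U \<subseteq> U') (?H X A) (\<lambda>_. ?r X A) =
      direct_limit I (\<lambda>U' U. U \<subseteq> U') (\<lambda>U. ?H (X - B) (A - B) (?\<rho> U)) (\<lambda>U' U. ?r (X - B) (A - B) (?\<rho> U))"
  proof (rule direct_limit_cong)
    show "?H X A U = ?H (X - B) (A - B) (?\<rho> U)" if "U \<in> I" for U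
      unfolding res exc[OF that] by (rule cohomology_excision) (rule face_closed_vr_complex)
    show "?r X A U \<xi> = ?r (X - B) (A - B) (?\<rho> U) \<xi>"
      if "U' \<in> I" "U \<in> I" "U \<subseteq> U'" "\<xi> \<in> carrier (?H X A U')" for U' U \<xi>
      unfolding res exc[OF that(2)]
    proof (rule cohomology_restriction_excision[OF _ face_closed_vr_complex _ _ that(4)])
      show "simplicial_pair (vr_complex X U') (vr_complex A U')"
        using assms(3) by (rule simplicial_pair_vr_complex)
      show "vr_complex (X - B) U \<union> vr_complex A U \<subseteq> vr_complex X U'"
        using exc[OF that(2)] vr_complex_mono[OF that(3)] by metis
      show "vr_complex A U \<subseteq> vr_complex A U'"
        by (rule vr_complex_mono) fact
    qed
  qed
  with iso' have "direct_limit I (\<lambda>U' U. U \<subseteq> U') (?H X A) (\<lambda>_. ?r X A) \<cong> vr_cohomology q (X - B) (A - B) ?F' G"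
    by simp
  then have cohomology: "vr_cohomology q (X - B) (A - B) ?F' G \<cong> vr_cohomology q X A F G"
    by (rule iso_trans[OF group.iso_sym[OF CI.D.is_group] iso])

  let ?h = "\<lambda>X A U. simplicial_homology q (vr_complex X U) (vr_complex A U) G"
  let ?i = "\<lambda>X A U. homology_inclusion q (vr_complex X U) (vr_complex A U) G"
  interpret E: functorial_system F "\<lambda>U U'. U \<subseteq> U'" "?h X A" "\<lambda>_. ?i X A"
    by (rule vr_homology_system) fact
  interpret E': functorial_system ?F' "\<lambda>U U'. U \<subseteq> U'" "?h (X - B) (A - B)" "\<lambda>_. ?i (X - B) (A - B)"
    by (rule vr_homology_system) fact
  have "inverse_limit I (\<lambda>U U'. U \<subseteq> U') (?h X A) (\<lambda>_. ?i X A) \<cong> vr_homology q X A F G"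
    unfolding vr_homology_eq
  \<comment> \<open>The cofinality lemma goes from \<open>F\<close> to \<open>I\<close>, so its
    isomorphism is reversed. Here \<phi> and all \<open>h i\<close> are identities.\<close>
  proof (rule group.iso_sym[OF E.inverse_limit_group])
    show "inverse_limit F (\<lambda>U U'. U \<subseteq> U') (?h X A) (\<lambda>_. ?i X A) \<cong> inverse_limit I (\<lambda>U U'. U \<subseteq> U') (?h X A) (\<lambda>_. ?i X A)"
      by (rule E.inverse_limit_cofinal[of I _ _ "\<lambda>U. U" "\<lambda>_ \<xi>. \<xi>"])
        (auto simp: iso_set_refl[unfolded id_def] intro: dir cofinal IF E.grp)
  qed
  \<comment> \<open>Now the lemma does both jobs at once: \<phi> is \<open>?\<rho>\<close>, and
    \<open>h U\<close> is the excision isomorphism at \<open>U\<close>.\<close>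
  moreover have "vr_homology q (X - B) (A - B) ?F' G \<cong> inverse_limit I (\<lambda>U U'. U \<subseteq> U') (?h X A) (\<lambda>_. ?i X A)"
    unfolding vr_homology_eq
  proof (rule E'.inverse_limit_cofinal[of I _ _ ?\<rho> "?i X A"])
    show "?i X A U \<in> iso (?h (X - B) (A - B) (?\<rho> U)) (?h X A U)" if "U \<in> I" for U
      unfolding res exc[OF that] by (intro homology_excision face_closed_vr_complex)
    show "?i X A V (?i X A U \<xi>) = ?i X A V (?i (X - B) (A - B) (?\<rho> V) \<xi>)"
      if "U \<in> I" "V \<in> I" "U \<subseteq> V" "\<xi> \<in> carrier (?h (X - B) (A - B) (?\<rho> U))" for U V \<xi>
    proof -
      note pairs = simplicial_pair_vr_complex[OF assms(3)] simplicial_pair_vr_complex[OF sub]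
      have s: "vr_complex (X - B) U \<subseteq> vr_complex X U" "vr_complex (A - B) U \<subseteq> vr_complex A U"
        "vr_complex (X - B) V \<subseteq> vr_complex X V" "vr_complex (A - B) V \<subseteq> vr_complex A V"
        using exc[OF that(1)] exc[OF that(2)] by auto
      \<comment> \<open>Both composites equal the map induced by the inclusion of the pair on
        \<open>X - B\<close> at \<open>U\<close> into the pair on \<open>X\<close> at
        \<open>V\<close>.\<close>
      have "?i X A V (?i X A U \<xi>) = ?i X A V \<xi>"
        using that(4) unfolding res by (intro homology_inclusion_comp[of "vr_complex (X - B) U" "vr_complex (A - B) U"] pairs s vr_complex_mono that(3))
      also have "\<dots> = ?i X A V (?i (X - B) (A - B) V \<xi>)"
        using that(4) unfolding res by (intro homology_inclusion_comp[of "vr_complex (X - B) U" "vr_complex (A - B) U", symmetric] pairs s vr_complex_mono that(3))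
      finally show ?thesis by (simp add: res)
    qed
  qed (use dir cofinal' \<rho>_mono IF E.grp in auto)
  ultimately have "vr_homology q (X - B) (A - B) ?F' G \<cong> vr_homology q X A F G"
    using iso_trans by blast
  with cohomology show ?thesis
    using trace_structure_iso[OF assms(1) _ sub] by (meson Diff_subset iso_trans)
qed

end
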